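(* Let $G$ be a connected graph. Then the $h^\ast$-vector of $\mathrm{CBP}(G)$ is unimodal.
   Context: Graphs are finite, simple and undirected. A connected graph is 2-connected if it has at least three vertices and remains connected after deleting any single vertex. A bridge is an edge whose deletion increases the number of connected components. A block of $G$ is a maximal 2-connected subgraph of $G$ or a bridge together with its two end vertices; $\mathcal{B}$ denotes the set of blocks of $G$. For $\mathcal{A}\subseteq\mathcal{B}$ let $G[\mathcal{A}]=\bigcup_{B\in\mathcal{A}}B$ (the empty graph counts as connected), and let $\chi^{\mathcal{A}}\in\{0,1\}^{\mathcal{B}}$ be the incidence vector of $\mathcal{A}$. The connected blocks polytope is $\mathrm{CBP}(G)=\mathrm{conv}\{\chi^{\mathcal{A}}\mid \mathcal{A}\subseteq\mathcal{B},\ G[\mathcal{A}]\text{ connected}\}\subseteq\mathbb{R}^{\mathcal{B}}$. For a $d$-dimensional lattice polytope $P$, the $h^\ast$-vector $(h_0^\ast,\dots,h_d^\ast)$ is defined by $|nP\cap\mathbb{Z}^{\mathcal{B}}|=\sum_{i=0}^d h_i^\ast\binom{n+d-i}{d}$ for all integers $n\ge 0$. A sequence $(a_0,\dots,a_d)$ is unimodal if $a_0\le\dots\le a_j\ge\dots\ge a_d$ for some $j$. *)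

theory Defs
  imports "HOL-Analysis.Analysis"
begin

section \<open>Finite simple graphs\<close>

text \<open>A graph is a pair of a vertex set and an edge set. Over a finite type \<open>'a\<close> of potential
  vertices, \<open>'a graph\<close> is itself a finite type and may index the coordinates of a vector.\<close>

type_synonym 'a graph = "'a set \<times> 'a set set"

abbreviation verts :: "'a graph \<Rightarrow> 'a set" where "verts \<equiv> fst"
abbreviation edges :: "'a graph \<Rightarrow> 'a set set" where "edges \<equiv> snd"

definition simple_graph :: "'a graph \<Rightarrow> bool" where
  "simple_graph G \<longleftrightarrow> finite (verts G) \<and> (\<forall>e\<in>edges G. e \<subseteq> verts G \<and> card e = 2)"

definition subgraph :: "'a graph \<Rightarrow> 'a graph \<Rightarrow> bool" where
  "subgraph H G \<longleftrightarrow> simple_graph H \<and> verts H \<subseteq> verts G \<and> edges H \<subseteq> edges G"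

definition reachability :: "'a graph \<Rightarrow> ('a \<times> 'a) set" where
  "reachability G = {(u, v). u \<in> verts G \<and> v \<in> verts G \<and> (u, v) \<in> {(x, y). {x, y} \<in> edges G}\<^sup>*}"

definition components_of_graph :: "'a graph \<Rightarrow> 'a set set" where
  "components_of_graph G = verts G // reachability G"

text \<open>The graph without vertices counts as connected.\<close>

definition connected_graph :: "'a graph \<Rightarrow> bool" where
  "connected_graph G \<longleftrightarrow> (\<forall>u\<in>verts G. \<forall>v\<in>verts G. (u, v) \<in> reachability G)"

definition delete_vertex :: "'a \<Rightarrow> 'a graph \<Rightarrow> 'a graph" where
  "delete_vertex v G = (verts G - {v}, {e \<in> edges G. v \<notin> e})"

definition delete_edge :: "'a set \<Rightarrow> 'a graph \<Rightarrow> 'a graph" where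
  "delete_edge e G = (verts G, edges G - {e})"

definition two_connected :: "'a graph \<Rightarrow> bool" where
  "two_connected G \<longleftrightarrow> connected_graph G \<and> 3 \<le> card (verts G) \<and>
     (\<forall>v\<in>verts G. connected_graph (delete_vertex v G))"

definition bridge :: "'a graph \<Rightarrow> 'a set \<Rightarrow> bool" where
  "bridge G e \<longleftrightarrow> e \<in> edges G \<and>
     card (components_of_graph G) < card (components_of_graph (delete_edge e G))"

definition maximal_two_connected_subgraph :: "'a graph \<Rightarrow> 'a graph \<Rightarrow> bool" where
  "maximal_two_connected_subgraph G B \<longleftrightarrow> subgraph B G \<and> two_connected B \<and>
     (\<forall>H. subgraph H G \<and> two_connected H \<and> subgraph B H \<longrightarrow> H = B)"

definition blocks :: "'a graph \<Rightarrow> 'a graph set" where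
  "blocks G = {B. maximal_two_connected_subgraph G B} \<union> {(e, {e}) | e. bridge G e}"

definition graph_Union :: "'a graph set \<Rightarrow> 'a graph" where
  "graph_Union \<A> = (\<Union>(verts ` \<A>), \<Union>(edges ` \<A>))"


section \<open>The connected blocks polytope\<close>

text \<open>The space of real vectors indexed by \<^term>\<open>blocks G\<close> is realised as the coordinate subspace of
  \<open>real ^ 'a graph\<close> of those vectors that vanish at every index outside \<^term>\<open>blocks G\<close>. Since
  the polytope and all its dilates lie in this subspace, neither its dimension nor the integer
  points of its dilates are affected by the additional coordinates.\<close>

definition incidence_vector :: "'b::finite set \<Rightarrow> real ^ 'b" where
  "incidence_vector A = (\<chi> b. if b \<in> A then 1 else 0)"

definition connected_blocks_polytope :: "'a::finite graph \<Rightarrow> (real ^ 'a graph) set" where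
  "connected_blocks_polytope G =
     convex hull {incidence_vector \<A> | \<A>. \<A> \<subseteq> blocks G \<and> connected_graph (graph_Union \<A>)}"


section \<open>The $h^\ast$-vector and unimodality\<close>

definition ehrhart_count :: "(real ^ 'b::finite) set \<Rightarrow> nat \<Rightarrow> nat" where
  "ehrhart_count P n = card {x \<in> (\<lambda>p. real n *\<^sub>R p) ` P. \<forall>b. x $ b \<in> \<int>}"

text \<open>In the following sum the natural-number subtraction never truncates, as \<open>i \<le> d\<close>.\<close>

definition is_hstar_vector :: "(real ^ 'b::finite) set \<Rightarrow> int list \<Rightarrow> bool" where
  "is_hstar_vector P h \<longleftrightarrow>
     (let d = nat (aff_dim P) in
        length h = d + 1 \<and>
        (\<forall>n. int (ehrhart_count P n) = (\<Sum>i=0..d. h ! i * int ((n + d - i) choose d))))"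

text \<open>Evaluating the defining identity at \<open>n = 0, \<dots>, d\<close> gives a unitriangular system with
  integer right-hand side, so the vector is unique and integral; that it exists for every nonempty
  lattice polytope is Ehrhart's theorem.\<close>

definition hstar_vector :: "(real ^ 'b::finite) set \<Rightarrow> int list" where
  "hstar_vector P = (THE h. is_hstar_vector P h)"

definition unimodal :: "'c::linorder list \<Rightarrow> bool" where
  "unimodal a \<longleftrightarrow> (\<exists>j<length a.
     (\<forall>i<j. a ! i \<le> a ! Suc i) \<and>
     (\<forall>i. j \<le> i \<and> Suc i < length a \<longrightarrow> a ! Suc i \<le> a ! i))"

end

theory Submission
  imports Defs
begin

text \<open>The blocks of \<open>G\<close>, adjacent when they share a vertex, form a block graph \<open>E\<close>: a block meets a
  connected union of other blocks in at most one vertex, since otherwise an ear could be attached to it.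
  For \<open>x \<in> \<nat>\<^sup>\<B>\<close> let \<open>f x\<close> be the total number of components of the level sets \<open>{x \<ge> j}\<close>,
  \<open>j \<ge> 1\<close>. Decomposing \<open>x\<close> into these components, and using that \<open>f\<close> is convex, one sees that the lattice
  points of \<open>n P\<close> are the \<open>x\<close> with \<open>f x \<le> n\<close>. Hence the \<open>h\<^sup>*\<close>-polynomial of \<open>P\<close> is
  \<open>h\<^sub>V(t) = (1 - t)\<^bsup>|V|\<^esup> \<Sum>\<^sub>x t\<^bsup>f x\<^esup>\<close> with \<open>V = \<B>\<close>.

  If \<open>V\<close> is connected with at least two elements and \<open>v\<close> is not a cut vertex of \<open>V\<close>, then \<open>v\<close> is simplicial, and summing over the value
  of \<open>x\<close> at \<open>v\<close> gives, with \<open>W = V - {v}\<close>,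
  \<open>h\<^sub>V = (1 + t) h\<^sub>W + t \<Sum>\<^sub>S h\<^sub>S h\<^bsub>W/S\<^esub>\<close>, where \<open>S\<close> runs over the proper connected subsets of \<open>W\<close>
  that contain a neighbour of \<open>v\<close>, and \<open>W/S\<close> is \<open>W - S\<close> with all neighbours of \<open>S\<close> made adjacent. By induction
  \<open>h\<^sub>V\<close> is a nonnegative combination of the polynomials \<open>t\<^sup>i (1 + t)\<^bsup>D - 2 i\<^esup>\<close> with \<open>D = |V| - 1\<close>, which are
  symmetric and unimodal with the same centre. If \<open>V\<close> is disconnected, \<open>h\<^sub>V\<close> is the product over the components.\<close>

section \<open>Connected sets and components\<close>

text \<open>Connectedness by cuts instead of paths, which suits arguments about closed subsets. The
  empty set is connected, in agreement with the empty graph.\<close>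

definition conn :: "('b \<Rightarrow> 'b \<Rightarrow> bool) \<Rightarrow> 'b set \<Rightarrow> bool" where
  "conn E S \<longleftrightarrow> (\<forall>A\<subseteq>S. A \<noteq> {} \<longrightarrow> (\<forall>a\<in>A. \<forall>b\<in>S - A. \<not> E a b) \<longrightarrow> A = S)"

definition comps :: "('b \<Rightarrow> 'b \<Rightarrow> bool) \<Rightarrow> 'b set \<Rightarrow> 'b set set" where
  "comps E X = {S. S \<subseteq> X \<and> S \<noteq> {} \<and> conn E S \<and> (\<forall>a\<in>S. \<forall>b\<in>X - S. \<not> E a b)}"

definition nbrs :: "('b \<Rightarrow> 'b \<Rightarrow> bool) \<Rightarrow> 'b set \<Rightarrow> 'b set" where
  "nbrs E S = {a. \<exists>s\<in>S. E a s}"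

text \<open>Models deleting \<open>S\<close> and making its outer neighbours a clique; it is meant
  for vertices outside \<open>S\<close>, although \<open>nbrs E S\<close> may meet \<open>S\<close>.
  The loops it creates are invisible to \<open>conn\<close> and \<open>comps\<close>, which only
  look at edges between disjoint sets.\<close>

definition contract :: "('b \<Rightarrow> 'b \<Rightarrow> bool) \<Rightarrow> 'b set \<Rightarrow> 'b \<Rightarrow> 'b \<Rightarrow> bool" where
  "contract E S a b \<longleftrightarrow> E a b \<or> (a \<in> nbrs E S \<and> b \<in> nbrs E S)"

lemma connD:
  assumes "conn E S" "A \<subseteq> S" "A \<noteq> {}" "\<And>a b. a \<in> A \<Longrightarrow> b \<in> S - A \<Longrightarrow> \<not> E a b"
  shows "A = S"
  using assms unfolding conn_def by blast

lemma connI: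
  assumes "\<And>A. A \<subseteq> S \<Longrightarrow> A \<noteq> {} \<Longrightarrow> (\<And>a b. a \<in> A \<Longrightarrow> b \<in> S - A \<Longrightarrow> \<not> E a b) \<Longrightarrow> S \<subseteq> A"
  shows "conn E S"
  unfolding conn_def using assms by (metis subset_antisym)

lemma conn_empty [simp]: "conn E {}"
  by (simp add: conn_def)

lemma conn_singleton [simp]: "conn E {v}"
  by (auto simp: conn_def)

lemma symp_contract: "symp E \<Longrightarrow> symp (contract E S)"
  unfolding contract_def symp_def by blast

lemma compsD:
  assumes "S \<in> comps E X"
  shows "S \<subseteq> X" "S \<noteq> {}" "conn E S" "\<And>a b. a \<in> S \<Longrightarrow> b \<in> X \<Longrightarrow> b \<notin> S \<Longrightarrow> \<not> E a b"
  using assms unfolding comps_def by blast+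

lemma compsI:
  assumes "S \<subseteq> X" "S \<noteq> {}" "conn E S" "\<And>a b. a \<in> S \<Longrightarrow> b \<in> X \<Longrightarrow> b \<notin> S \<Longrightarrow> \<not> E a b"
  shows "S \<in> comps E X"
  using assms unfolding comps_def by blast

text \<open>Inside \<open>S\<close>, the part \<open>S \<inter> T\<close> has no edge to the rest of
  \<open>S\<close>, because \<open>T\<close> has none to the rest of \<open>X\<close>.\<close>

lemma conn_subset_comp:
  assumes "symp E" "T \<in> comps E X" "S \<subseteq> X" "conn E S" "S \<inter> T \<noteq> {}"
  shows "S \<subseteq> T"
proof -
  have "S \<inter> T = S"
    using assms compsD[OF assms(2)] by (intro connD[of E S]) (auto dest: sympD)
  then show ?thesis by blast
qed

lemma comps_eqI:
  assumes "symp E" "S \<in> comps E X" "T \<in> comps E X" "S \<inter> T \<noteq> {}"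
  shows "S = T"
  using conn_subset_comp[OF assms(1,3)] conn_subset_comp[OF assms(1,2), of T] compsD[OF assms(2)] compsD[OF assms(3)]
    assms(4) by blast

text \<open>The component of \<open>x\<close> is the intersection of all closed sets containing
  \<open>x\<close>. If a part without outgoing edges splits off from it, then by symmetry of
  \<open>E\<close> both pieces are closed, and the one containing \<open>x\<close> is already
  everything.\<close>

lemma Union_comps:
  assumes "symp E"
  shows "\<Union> (comps E X) = X"
proof
  show "\<Union> (comps E X) \<subseteq> X" by (auto dest: compsD(1))
  show "X \<subseteq> \<Union> (comps E X)"
  proof
    fix x assume x: "x \<in> X"
    define closed where "closed A \<longleftrightarrow> A \<subseteq> X \<and> (\<forall>a\<in>A. \<forall>b\<in>X - A. \<not> E a b)" for A
    define C where "C = \<Inter> {A. closed A \<and> x \<in> A}"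
    have X: "closed X" by (auto simp: closed_def)
    have CX: "C \<subseteq> X" using X x unfolding C_def by blast
    have xC: "x \<in> C" unfolding C_def by blast
    have cC: "closed C" unfolding closed_def using CX by (auto simp: C_def closed_def)
    have "conn E C"
    proof (rule connI)
      fix A assume A: "A \<subseteq> C" "A \<noteq> {}" "\<And>a b. a \<in> A \<Longrightarrow> b \<in> C - A \<Longrightarrow> \<not> E a b"
      have "closed A"
        using A CX cC unfolding closed_def by blast
      have cl2: "closed (C - A)"
        using A CX cC assms unfolding closed_def by (blast dest: sympD)
      show "C \<subseteq> A"
      proof (cases "x \<in> A")
        case True
        with \<open>closed A\<close> show ?thesis unfolding C_def by blast
      next
        case False
        with cl2 xC have "C \<subseteq> C - A" unfolding C_def by blast
        with A show ?thesis by blast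
      qed
    qed
    then have "C \<in> comps E X" using cC CX xC unfolding closed_def comps_def by blast
    with xC show "x \<in> \<Union> (comps E X)" by blast
  qed
qed

text \<open>Reduces the computation of components to exhibiting a partition: each of its parts is
  closed in \<open>X\<close>, and a component that meets a part coincides with it.\<close>

lemma comps_partitionI:
  assumes "symp E" "\<Union> P = X"
    and P: "\<And>S. S \<in> P \<Longrightarrow> S \<noteq> {} \<and> conn E S"
    and sep: "\<And>S T a b. S \<in> P \<Longrightarrow> T \<in> P \<Longrightarrow> S \<noteq> T \<Longrightarrow> a \<in> S \<Longrightarrow> b \<in> T \<Longrightarrow> a \<noteq> b \<and> \<not> E a b"
  shows "comps E X = P"
proof
  show sub: "P \<subseteq> comps E X"
  proof
    fix S assume S: "S \<in> P"
    show "S \<in> comps E X"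
    proof (rule compsI)
      show "S \<subseteq> X" using S assms(2) by blast
      show "S \<noteq> {}" "conn E S" using P[OF S] by simp_all
      fix a b assume ab: "a \<in> S" "b \<in> X" "b \<notin> S"
      then obtain T where "T \<in> P" "b \<in> T" using assms(2) by blast
      then show "\<not> E a b" using sep[OF S, of T a b] ab by blast
    qed
  qed
  show "comps E X \<subseteq> P"
  proof
    fix T assume T: "T \<in> comps E X"
    then obtain x where "x \<in> T" "x \<in> X" using compsD(1,2)[OF T] by blast
    then obtain S where S: "S \<in> P" "x \<in> S" using assms(2) by blast
    then have "S = T" using comps_eqI[OF assms(1) _ T] sub \<open>x \<in> T\<close> by blast
    with S show "T \<in> P" by simp
  qed
qed

lemma comps_empty [simp]: "comps E {} = {}"
  by (auto simp: comps_def)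

lemma finite_comps [simp]: "finite X \<Longrightarrow> finite (comps E X)"
  by (rule finite_subset[of _ "Pow X"]) (auto simp: comps_def)

lemma comps_nonempty:
  assumes "symp E" "X \<noteq> {}"
  shows "comps E X \<noteq> {}"
  using Union_comps[OF assms(1), of X] assms(2) by auto

lemma comps_conn:
  assumes "symp E" "conn E S" "S \<noteq> {}"
  shows "comps E S = {S}"
  by (rule comps_partitionI[OF assms(1)]) (use assms in auto)

section \<open>Components after adding a touching or a separated vertex set\<close>

lemma conn_Un_touching:
  assumes "symp E" "conn E S" "S \<noteq> {}" "\<And>T. T \<in> \<T> \<Longrightarrow> conn E T \<and> T \<inter> nbrs E S \<noteq> {}"
  shows "conn E (S \<union> \<Union>\<T>)"
proof (rule connI)
  fix A assume A: "A \<subseteq> S \<union> \<Union>\<T>" "A \<noteq> {}" "\<And>a b. a \<in> A \<Longrightarrow> b \<in> S \<union> \<Union>\<T> - A \<Longrightarrow> \<not> E a b"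
  have TA: "T \<subseteq> A" if "T \<in> \<T>" "A \<inter> T \<noteq> {}" for T
    using connD[of E T "A \<inter> T"] A assms(4) that by blast
  have SA: "S \<subseteq> A" if "A \<inter> S \<noteq> {}"
    using connD[of E S "A \<inter> S"] A assms(2) that by blast
  \<comment> \<open>A closed part that meets some \<open>T\<close> swallows it, and \<open>T\<close>
    has an edge into \<open>S\<close>; so the part meets \<open>S\<close> in any case.\<close>
  have "A \<inter> S \<noteq> {}"
  proof (cases "A \<inter> S = {}")
    case True
    then obtain T where T: "T \<in> \<T>" "A \<inter> T \<noteq> {}" using A by blast
    then have "T \<subseteq> A" using TA by blast
    then obtain a s where "a \<in> A" "s \<in> S" "E a s" using assms(4) T(1) unfolding nbrs_def by blast
    then show ?thesis using A(3) by blast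
  qed
  then have "S \<subseteq> A" by (rule SA)
  moreover have "T \<subseteq> A" if T: "T \<in> \<T>" for T
  proof -
    obtain a s where "a \<in> T" "s \<in> S" "E a s" using assms(4) T unfolding nbrs_def by blast
    then have "E s a" "s \<in> A" using \<open>S \<subseteq> A\<close> assms(1) by (auto dest: sympD)
    then have "a \<in> A" using A(3) \<open>a \<in> T\<close> T by blast
    then show ?thesis using TA T \<open>a \<in> T\<close> by blast
  qed
  ultimately show "S \<union> \<Union>\<T> \<subseteq> A" by blast
qed

lemma comps_apart:
  assumes "symp E" "S \<in> comps E Z" "T \<in> comps E Z" "S \<noteq> T" "a \<in> S" "b \<in> T"
  shows "a \<noteq> b \<and> \<not> E a b"
proof -
  have "b \<notin> S" using comps_eqI[OF assms(1-3)] assms(4,6) by blast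
  moreover have "b \<in> Z" using compsD(1)[OF assms(3)] assms(6) by blast
  ultimately show ?thesis using compsD(4)[OF assms(2,5)] assms(5) by blast
qed

text \<open>\<open>S\<close> fuses with precisely those components of \<open>Z\<close> that it
  touches; the others have no edge to the fused set.\<close>

lemma comps_Un_conn:
  assumes "symp E" "conn E S" "S \<noteq> {}" "S \<inter> Z = {}"
  shows "comps E (S \<union> Z) =
    insert (S \<union> \<Union>{T \<in> comps E Z. T \<inter> nbrs E S \<noteq> {}}) {T \<in> comps E Z. T \<inter> nbrs E S = {}}"
    (is "_ = insert ?M ?R")
proof (rule comps_partitionI[OF assms(1)])
  have "?R \<union> {T \<in> comps E Z. T \<inter> nbrs E S \<noteq> {}} = comps E Z" by blast
  from arg_cong[OF this, of Union]
  have U: "\<Union>?R \<union> \<Union>{T \<in> comps E Z. T \<inter> nbrs E S \<noteq> {}} = Z"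
    by (simp only: Union_Un_distrib Union_comps[OF assms(1)])
  show "\<Union> (insert ?M ?R) = S \<union> Z"
    using U by (simp only: Union_insert Un_ac)
  have "conn E ?M"
    by (rule conn_Un_touching[OF assms(1-3)]) (auto dest: compsD(3))
  then show "T \<noteq> {} \<and> conn E T" if "T \<in> insert ?M ?R" for T
    using that assms(3) by (auto dest: compsD(2,3))
  have MR: "a \<noteq> b \<and> \<not> E a b \<and> \<not> E b a" if T: "T \<in> ?R" "a \<in> T" "b \<in> ?M" for T a b
  proof (cases "b \<in> S")
    case True
    moreover have "a \<in> Z" using compsD(1)[of T] T by blast
    ultimately show ?thesis using T(1,2) assms(1,4) unfolding nbrs_def by (blast dest: sympD)
  next
    case False
    then obtain T' where T': "T' \<in> comps E Z" "T' \<inter> nbrs E S \<noteq> {}" "b \<in> T'" using T by blast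
    have T1: "T \<in> comps E Z" "T \<noteq> T'" using T T' by blast+
    show ?thesis
      using comps_apart[OF assms(1) T1(1) T'(1) T1(2) T(2) T'(3)] assms(1) by (blast dest: sympD)
  qed
  show "a \<noteq> b \<and> \<not> E a b"
    if T: "T \<in> insert ?M ?R" "T' \<in> insert ?M ?R" "T \<noteq> T'" "a \<in> T" "b \<in> T'" for T T' a b
  proof (cases "T \<in> ?R")
    case TR: True
    show ?thesis
    proof (cases "T' \<in> ?R")
      case True
      with TR have "T \<in> comps E Z" "T' \<in> comps E Z" by blast+
      from comps_apart[OF assms(1) this T(3-5)] show ?thesis .
    next
      case False
      with T(2) have "T' = ?M" by blast
      then show ?thesis using MR[OF TR T(4)] T(5) by blast
    qed
  next
    case False
    with T(1) have TM: "T = ?M" by blast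
    with T(2,3) have "T' \<in> ?R" by blast
    from MR[OF this T(5)] show ?thesis using T(4) unfolding TM by blast
  qed
qed

lemma card_comps_Un_conn:
  assumes "symp E" "conn E S" "S \<noteq> {}" "S \<inter> Z = {}" "finite Z"
  shows "card (comps E (S \<union> Z)) = Suc (card {T \<in> comps E Z. T \<inter> nbrs E S = {}})"
proof -
  have "S \<union> \<Union>{T \<in> comps E Z. T \<inter> nbrs E S \<noteq> {}} \<notin> {T \<in> comps E Z. T \<inter> nbrs E S = {}}"
    using assms(3,4) compsD(1)[of _ E Z] by blast
  then show ?thesis using assms by (simp add: comps_Un_conn)
qed

lemma comps_Un_apart:
  assumes "symp E" "Y \<inter> Z = {}" "\<And>y z. y \<in> Y \<Longrightarrow> z \<in> Z \<Longrightarrow> \<not> E y z"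
  shows "comps E (Y \<union> Z) = comps E Y \<union> comps E Z"
proof (rule comps_partitionI[OF assms(1)])
  show "\<Union> (comps E Y \<union> comps E Z) = Y \<union> Z" using Union_comps[OF assms(1)] by simp
  show "S \<noteq> {} \<and> conn E S" if "S \<in> comps E Y \<union> comps E Z" for S
    using that compsD(2,3)[of S] by blast
  have sep: "a \<noteq> b \<and> \<not> E a b \<and> \<not> E b a" if "S \<in> comps E Y" "T \<in> comps E Z" "a \<in> S" "b \<in> T" for S T a b
  proof -
    have "a \<in> Y" "b \<in> Z" using that compsD(1)[of S E Y] compsD(1)[of T E Z] by blast+
    then show ?thesis using assms by (blast dest: sympD)
  qed
  show "a \<noteq> b \<and> \<not> E a b"
    if "S \<in> comps E Y \<union> comps E Z" "T \<in> comps E Y \<union> comps E Z" "S \<noteq> T" "a \<in> S" "b \<in> T" for S T a b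
    using that(1,2)
  proof (elim UnE)
    assume "S \<in> comps E Y" "T \<in> comps E Y"
    then show ?thesis by (rule comps_apart[OF assms(1) _ _ that(3-5)])
  next
    assume "S \<in> comps E Z" "T \<in> comps E Z"
    then show ?thesis by (rule comps_apart[OF assms(1) _ _ that(3-5)])
  next
    assume "S \<in> comps E Y" "T \<in> comps E Z"
    from sep[OF this that(4,5)] show ?thesis by blast
  next
    assume "S \<in> comps E Z" "T \<in> comps E Y"
    from sep[OF this(2,1) that(5,4)] show ?thesis by blast
  qed
qed

lemma card_comps_Un_apart:
  assumes "symp E" "Y \<inter> Z = {}" "\<And>y z. y \<in> Y \<Longrightarrow> z \<in> Z \<Longrightarrow> \<not> E y z" "finite Y" "finite Z"
  shows "card (comps E (Y \<union> Z)) = card (comps E Y) + card (comps E Z)"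
proof -
  have "comps E Y \<inter> comps E Z = {}" using assms(2) compsD(1)[of _ E Y] compsD(1)[of _ E Z] compsD(2)[of _ E Y] by blast
  then show ?thesis using assms by (simp add: comps_Un_apart card_Un_disjoint)
qed

section \<open>Components after contracting a connected set\<close>

lemma conn_cong:
  assumes "\<And>a b. a \<in> S \<Longrightarrow> b \<in> S \<Longrightarrow> E a b \<longleftrightarrow> E' a b"
  shows "conn E S \<longleftrightarrow> conn E' S"
proof -
  have "(\<forall>a\<in>A. \<forall>b\<in>S - A. \<not> E a b) \<longleftrightarrow> (\<forall>a\<in>A. \<forall>b\<in>S - A. \<not> E' a b)" if "A \<subseteq> S" for A
    using assms that by blast
  then show ?thesis by (simp only: conn_def cong: imp_cong)
qed

lemma contract_off: "a \<notin> nbrs E S \<Longrightarrow> contract E S a b \<longleftrightarrow> E a b"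
  by (simp add: contract_def)

lemma conn_contract_off: "S' \<inter> nbrs E S = {} \<Longrightarrow> conn (contract E S) S' \<longleftrightarrow> conn E S'"
  by (rule conn_cong) (auto simp: contract_def)

lemma comps_contract_apart:
  assumes "Z \<inter> nbrs E S = {}"
  shows "comps (contract E S) Z = comps E Z"
proof (rule set_eqI)
  fix T
  show "T \<in> comps (contract E S) Z \<longleftrightarrow> T \<in> comps E Z"
  proof (cases "T \<subseteq> Z")
    case True
    with assms have T: "T \<inter> nbrs E S = {}" by blast
    then have "contract E S a b \<longleftrightarrow> E a b" if "a \<in> T" for a b
      using that contract_off by fastforce
    then show ?thesis by (simp add: comps_def conn_contract_off[OF T])
  qed (simp add: comps_def)
qed

text \<open>Contraction joins the neighbours of \<open>S\<close> pairwise, so all components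
  containing one fuse, while the others receive no new edge.\<close>

lemma comps_contract_touching:
  assumes "symp E" "Z \<inter> nbrs E S \<noteq> {}"
  shows "comps (contract E S) Z =
    insert (\<Union>{T \<in> comps E Z. T \<inter> nbrs E S \<noteq> {}}) {T \<in> comps E Z. T \<inter> nbrs E S = {}}"
    (is "comps ?E Z = insert ?M ?R")
proof (rule comps_partitionI[OF symp_contract[OF assms(1)]])
  have "?R \<union> {T \<in> comps E Z. T \<inter> nbrs E S \<noteq> {}} = comps E Z" by blast
  from arg_cong[OF this, of Union]
  have UZ: "\<Union>?R \<union> ?M = Z"
    by (simp only: Union_Un_distrib Union_comps[OF assms(1)])
  show "\<Union> (insert ?M ?R) = Z"
    using UZ by (simp only: Union_insert Un_commute)
  have NM: "Z \<inter> nbrs E S \<subseteq> ?M"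
  proof
    fix z assume "z \<in> Z \<inter> nbrs E S"
    then have "z \<in> \<Union>?R \<union> ?M" "z \<in> nbrs E S" using UZ by simp_all
    then show "z \<in> ?M" by blast
  qed
  have "conn ?E ?M"
  proof (rule connI)
    fix A assume A: "A \<subseteq> ?M" "A \<noteq> {}" "\<And>a b. a \<in> A \<Longrightarrow> b \<in> ?M - A \<Longrightarrow> \<not> ?E a b"
    have TA: "T \<subseteq> A" if T: "T \<in> comps E Z" "T \<inter> nbrs E S \<noteq> {}" "A \<inter> T \<noteq> {}" for T
    proof -
      have "T \<subseteq> ?M" using T by blast
      then have "\<not> E a b" if "a \<in> A \<inter> T" "b \<in> T - A \<inter> T" for a b
        using A(3)[of a b] that unfolding contract_def by blast
      then have "A \<inter> T = T" using T(3)
        by (intro connD[OF compsD(3)[OF T(1)]]) auto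
      then show ?thesis by blast
    qed
    obtain T where T: "T \<in> comps E Z" "T \<inter> nbrs E S \<noteq> {}" "A \<inter> T \<noteq> {}" using A(1,2) by blast
    then obtain t where t: "t \<in> A" "t \<in> nbrs E S" using TA[OF T] by blast
    have "T' \<subseteq> A" if T': "T' \<in> comps E Z" "T' \<inter> nbrs E S \<noteq> {}" for T'
    proof -
      obtain s where s: "s \<in> T'" "s \<in> nbrs E S" using T' by blast
      then have "?E t s" using t by (simp add: contract_def)
      moreover have "s \<in> ?M" using s T' by blast
      ultimately have "s \<in> A" using A(3)[OF t(1), of s] by blast
      then show ?thesis using TA[OF T'] s by blast
    qed
    then show "?M \<subseteq> A" by blast
  qed
  moreover have "?M \<noteq> {}" using NM assms(2) by blast
  ultimately have M: "?M \<noteq> {} \<and> conn ?E ?M" by (rule conjI[rotated])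
  have R: "T \<noteq> {} \<and> conn ?E T" if T: "T \<in> ?R" for T
  proof -
    have TZ: "T \<in> comps E Z" "T \<inter> nbrs E S = {}" using T by blast+
    then show ?thesis using compsD(2,3)[OF TZ(1)] conn_contract_off[OF TZ(2)] by simp
  qed
  show "T \<noteq> {} \<and> conn ?E T" if "T \<in> insert ?M ?R" for T
  proof (cases "T = ?M")
    case True
    show ?thesis unfolding True by (rule M)
  next
    case False
    have "T \<in> ?R" using that by (simp only: insert_iff False simp_thms)
    then show ?thesis by (rule R)
  qed
  have key: "a \<noteq> b \<and> \<not> ?E a b \<and> \<not> ?E b a"
    if T: "T \<in> ?R" "a \<in> T" "T' \<in> comps E Z" "b \<in> T'" "T \<noteq> T'" for T T' a b
  proof -
    have TZ: "T \<in> comps E Z" "a \<notin> nbrs E S" using T by blast+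
    show ?thesis using comps_apart[OF assms(1) TZ(1) T(3) T(5,2,4)] TZ(2) assms(1)
      unfolding contract_def by (blast dest: sympD)
  qed
  show "a \<noteq> b \<and> \<not> ?E a b"
    if T: "T \<in> insert ?M ?R" "T' \<in> insert ?M ?R" "T \<noteq> T'" "a \<in> T" "b \<in> T'" for T T' a b
  proof (cases "T \<in> ?R")
    case TR: True
    obtain T'' where "T'' \<in> comps E Z" "b \<in> T''" "T \<noteq> T''"
    proof (cases "T' \<in> ?R")
      case True
      then show ?thesis using that T(3,5) by blast
    next
      case False
      with T(2) have "T' = ?M" by blast
      with T(5) obtain T'' where "T'' \<in> comps E Z" "b \<in> T''" "T'' \<inter> nbrs E S \<noteq> {}" by blast
      then show ?thesis using that TR by blast
    qed
    then show ?thesis using key[OF TR T(4)] by blast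
  next
    case False
    with T(1) have TM: "T = ?M" by blast
    with T(2,3) have T'R: "T' \<in> ?R" by blast
    obtain T'' where "T'' \<in> comps E Z" "a \<in> T''" "T'' \<inter> nbrs E S \<noteq> {}" using T(4) unfolding TM by blast
    then show ?thesis using key[OF T'R T(5), of T'' a] T'R by blast
  qed
qed

text \<open>Adding \<open>S\<close> and contracting \<open>S\<close> fuse the same components of
  \<open>Z\<close>. The counts differ only if \<open>S\<close> touches nothing: then
  \<open>S\<close> is a component of its own but leaves no trace in the contraction.\<close>

lemma card_comps_Un_contract:
  assumes "symp E" "conn E S" "S \<noteq> {}" "S \<inter> Z = {}" "finite Z"
  shows "card (comps E (S \<union> Z)) =
    card (comps (contract E S) Z) + (if Z \<inter> nbrs E S = {} then 1 else 0)"
proof (cases "Z \<inter> nbrs E S = {}")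
  case True
  then have "{T \<in> comps E Z. T \<inter> nbrs E S = {}} = comps E Z" using compsD(1)[of _ E Z] by blast
  then show ?thesis using True assms by (simp add: card_comps_Un_conn comps_contract_apart)
next
  case False
  have "\<Union>{T \<in> comps E Z. T \<inter> nbrs E S \<noteq> {}} \<notin> {T \<in> comps E Z. T \<inter> nbrs E S = {}}"
  proof
    assume *: "\<Union>{T \<in> comps E Z. T \<inter> nbrs E S \<noteq> {}} \<in> {T \<in> comps E Z. T \<inter> nbrs E S = {}}"
    have "Z \<inter> nbrs E S \<subseteq> \<Union>{T \<in> comps E Z. T \<inter> nbrs E S \<noteq> {}}"
      using Union_comps[OF assms(1), of Z] by blast
    with * False show False by blast
  qed
  then show ?thesis using False assms
    by (simp add: card_comps_Un_conn comps_contract_touching)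
qed

text \<open>The new vertex and all components it touches become one. The additive form avoids
  truncated subtraction.\<close>

lemma card_comps_insert:
  assumes "symp E" "v \<notin> Z" "finite Z"
  shows "card (comps E (insert v Z)) + card {T \<in> comps E Z. T \<inter> nbrs E {v} \<noteq> {}} = Suc (card (comps E Z))"
proof -
  have "card (comps E Z) = card ({T \<in> comps E Z. T \<inter> nbrs E {v} = {}} \<union> {T \<in> comps E Z. T \<inter> nbrs E {v} \<noteq> {}})"
    by (rule arg_cong[of _ _ card]) blast
  also have "\<dots> = card {T \<in> comps E Z. T \<inter> nbrs E {v} = {}} + card {T \<in> comps E Z. T \<inter> nbrs E {v} \<noteq> {}}"
    using assms(3) by (intro card_Un_disjoint) auto
  finally show ?thesis
    using card_comps_Un_conn[OF assms(1) conn_singleton, of v Z] assms by simp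
qed

section \<open>Block graphs\<close>

text \<open>A finite graph all of whose blocks are cliques is characterised by the property that the
  neighbours of a vertex inside a connected set avoiding this vertex are pairwise adjacent.\<close>

definition block_graph :: "('b \<Rightarrow> 'b \<Rightarrow> bool) \<Rightarrow> 'b set \<Rightarrow> bool" where
  "block_graph E V \<longleftrightarrow> symp E \<and> (\<forall>A\<subseteq>V. conn E A \<longrightarrow>
     (\<forall>v\<in>V - A. \<forall>a\<in>A. \<forall>b\<in>A. E a v \<longrightarrow> E b v \<longrightarrow> a = b \<or> E a b))"

lemma block_graph_subset: "block_graph E V \<Longrightarrow> W \<subseteq> V \<Longrightarrow> block_graph E W"
  unfolding block_graph_def by (blast intro: subset_trans)

lemma block_graph_symp: "block_graph E V \<Longrightarrow> symp E"
  by (simp add: block_graph_def)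

lemma block_graphD:
  "block_graph E V \<Longrightarrow> A \<subseteq> V \<Longrightarrow> conn E A \<Longrightarrow> v \<in> V \<Longrightarrow> v \<notin> A \<Longrightarrow> a \<in> A \<Longrightarrow> b \<in> A \<Longrightarrow>
    E a v \<Longrightarrow> E b v \<Longrightarrow> a = b \<or> E a b"
  unfolding block_graph_def by blast

lemma conn_of_contract_apart:
  assumes "conn (contract E S) A" "A \<inter> nbrs E S = {}"
  shows "conn E A"
  using assms(1) conn_contract_off[OF assms(2)] by simp

text \<open>A closed part that misses \<open>S\<close> also misses the neighbours of
  \<open>S\<close>, hence is closed for the contraction and would be all of \<open>A\<close>. One
  that meets \<open>S\<close> contains \<open>S\<close>, then its neighbours, then
  \<open>A\<close>.\<close>

lemma conn_of_contract_touching: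
  assumes "symp E" "conn E S" "S \<inter> A = {}" "conn (contract E S) A" "A \<inter> nbrs E S \<noteq> {}"
  shows "conn E (S \<union> A)"
proof (rule connI)
  fix C assume C: "C \<subseteq> S \<union> A" "C \<noteq> {}" "\<And>a b. a \<in> C \<Longrightarrow> b \<in> S \<union> A - C \<Longrightarrow> \<not> E a b"
  show "S \<union> A \<subseteq> C"
  proof (cases "C \<inter> S = {}")
    case True
    then have CA: "C \<subseteq> A" using C by blast
    have CN: "C \<inter> nbrs E S = {}"
    proof (rule ccontr)
      assume "C \<inter> nbrs E S \<noteq> {}"
      then obtain a s where "a \<in> C" "s \<in> S" "E a s" unfolding nbrs_def by blast
      with C(3)[of a s] True show False by blast
    qed
    have "C = A"
    proof (rule connD[OF assms(4) CA C(2)])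
      fix a b assume ab: "a \<in> C" "b \<in> A - C"
      then have "a \<notin> nbrs E S" using CN by blast
      then show "\<not> contract E S a b" using C(3)[of a b] ab by (simp add: contract_off)
    qed
    then show ?thesis using CN assms(5) by blast
  next
    case False
    have "C \<inter> S = S" by (rule connD[OF assms(2)]) (use C False in auto)
    then have SC: "S \<subseteq> C" by blast
    have NC: "A \<inter> nbrs E S \<subseteq> C"
    proof
      fix a assume a: "a \<in> A \<inter> nbrs E S"
      then obtain s where "s \<in> S" "E s a" using assms(1) unfolding nbrs_def by (blast dest: sympD)
      then show "a \<in> C" using C(3)[of s a] SC a by blast
    qed
    have "C \<inter> A = A"
    proof (rule connD[OF assms(4)])
      show "C \<inter> A \<noteq> {}" using NC assms(5) by blast
      fix a b assume "a \<in> C \<inter> A" "b \<in> A - C \<inter> A"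
      then show "\<not> contract E S a b" using C(3)[of a b] NC unfolding contract_def by blast
    qed blast
    then show ?thesis using SC by blast
  qed
qed

text \<open>If \<open>A\<close> contains no neighbour of \<open>S\<close>, the contraction adds no
  edge at \<open>A\<close>. Otherwise \<open>S \<union> A\<close> is connected for \<open>E\<close>,
  and the block graph property of \<open>E\<close> is applied to this larger set.\<close>

lemma block_graph_contract:
  assumes "block_graph E V" "S \<subseteq> V" "conn E S"
  shows "block_graph (contract E S) (V - S)"
  unfolding block_graph_def
proof (intro conjI allI impI ballI)
  have sE: "symp E" using assms(1) by (rule block_graph_symp)
  show "symp (contract E S)" by (rule symp_contract[OF sE])
  fix A v a b
  assume A: "A \<subseteq> V - S" "conn (contract E S) A" "v \<in> V - S - A" "a \<in> A" "b \<in> A"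
    "contract E S a v" "contract E S b v"
  show "a = b \<or> contract E S a b"
  proof (cases "A \<inter> nbrs E S = {}")
    case True
    then have "conn E A" using conn_of_contract_apart A(2) by blast
    moreover have "E a v" "E b v" using A(4-7) True unfolding contract_def by blast+
    ultimately show ?thesis using block_graphD[OF assms(1), of A v a b] A(1,3,4,5) assms(2)
      unfolding contract_def by blast
  next
    case False
    then have cSA: "conn E (S \<union> A)" using conn_of_contract_touching[OF sE assms(3) _ A(2)] A(1) by blast
    \<comment> \<open>Both \<open>x\<close> and a neighbour \<open>s\<close> of \<open>v\<close> in
      \<open>S\<close> are neighbours of \<open>v\<close> in the connected set
      \<open>S \<union> A\<close>; hence they are adjacent.\<close>
    have nb: "x \<in> nbrs E S" if x: "x \<in> A" "E x v" "v \<in> nbrs E S" for x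
    proof -
      obtain s where s: "s \<in> S" "E s v" using x(3) sE unfolding nbrs_def by (blast dest: sympD)
      then have "x = s \<or> E x s" using block_graphD[OF assms(1) _ cSA, of v x s] A(1,3) x(1,2) assms(2) by blast
      then show ?thesis using s A(1) x(1) unfolding nbrs_def by blast
    qed
    show ?thesis
    proof (cases "v \<in> nbrs E S")
      case True
      then have "a \<in> nbrs E S" "b \<in> nbrs E S" using nb[OF A(4)] nb[OF A(5)] A(6,7) unfolding contract_def by blast+
      then show ?thesis by (simp add: contract_def)
    next
      case False
      then have "E a v" "E b v" using A(6,7) unfolding contract_def by blast+
      then have "a = b \<or> E a b" using block_graphD[OF assms(1) _ cSA, of v a b] A(1,3-5) assms(2) by blast
      then show ?thesis by (auto simp: contract_def)
    qed
  qed
qed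

text \<open>A closed part without neighbours of \<open>S\<close> is closed in \<open>V\<close> for
  \<open>E\<close>. Otherwise it contains all outer neighbours of \<open>S\<close>, and together
  with \<open>S\<close> it is closed in \<open>V\<close>.\<close>

lemma conn_contract:
  assumes "symp E" "conn E V" "S \<subseteq> V" "S \<noteq> {}"
  shows "conn (contract E S) (V - S)"
proof (rule connI)
  fix C assume C: "C \<subseteq> V - S" "C \<noteq> {}" "\<And>a b. a \<in> C \<Longrightarrow> b \<in> V - S - C \<Longrightarrow> \<not> contract E S a b"
  show "V - S \<subseteq> C"
  proof (cases "C \<inter> nbrs E S = {}")
    case True
    have "C = V"
    proof (rule connD[OF assms(2)])
      fix a b assume ab: "a \<in> C" "b \<in> V - C"
      then have "a \<notin> nbrs E S" using True by blast
      then show "\<not> E a b" using C(3)[of a b] ab by (cases "b \<in> S") (auto simp: contract_off nbrs_def)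
    qed (use C(1,2) in auto)
    then show ?thesis by blast
  next
    case False
    then obtain c where c: "c \<in> C" "c \<in> nbrs E S" by blast
    have NC: "a \<in> C" if "a \<in> V - S" "a \<in> nbrs E S" for a
      using C(3)[OF c(1), of a] that c(2) unfolding contract_def by blast
    have "C \<union> S = V"
    proof (rule connD[OF assms(2)])
      fix a b assume ab: "a \<in> C \<union> S" "b \<in> V - (C \<union> S)"
      show "\<not> E a b"
      proof
        assume E: "E a b"
        show False
        proof (cases "a \<in> C")
          case True
          then show False using C(3)[of a b] ab E by (simp add: contract_def)
        next
          case False
          with ab have "b \<in> nbrs E S" using E assms(1) by (auto simp: nbrs_def dest: sympD)
          then show False using NC[of b] ab by blast
        qed
      qed
    qed (use C(1,2) assms(3) in auto)
    then show ?thesis by blast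
  qed
qed

lemma conn_insert:
  assumes "symp E" "conn E S" "a \<in> S" "E a v"
  shows "conn E (insert v S)"
  using conn_Un_touching[OF assms(1) conn_singleton, of v "{S}"] assms
  by (auto simp: nbrs_def)

text \<open>Grow the set one vertex at a time along an edge that leaves it.\<close>

lemma ex_conn_subset:
  assumes "symp E" "conn E V" "finite V" "k \<le> card V"
  shows "\<exists>S\<subseteq>V. conn E S \<and> card S = k"
  using assms(4)
proof (induction k)
  case 0
  then show ?case by (intro exI[of _ "{}"]) auto
next
  case (Suc k)
  then obtain S where S: "S \<subseteq> V" "conn E S" "card S = k" by auto
  show ?case
  proof (cases "S = {}")
    case True
    then obtain v where "v \<in> V" using Suc S by fastforce
    then show ?thesis using S True by (intro exI[of _ "{v}"]) auto
  next
    case False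
    have "S \<noteq> V" using S Suc by auto
    then obtain a b where "a \<in> S" "b \<in> V - S" "E a b" using connD[OF assms(2) S(1) False] by blast
    then show ?thesis using S conn_insert[OF assms(1) S(2)] assms(3)
      by (intro exI[of _ "insert b S"]) (auto simp: finite_subset)
  qed
qed

lemma ex_noncut_vertex:
  assumes "symp E" "conn E V" "finite V" "V \<noteq> {}"
  shows "\<exists>v\<in>V. conn E (V - {v})"
proof -
  obtain S where S: "S \<subseteq> V" "conn E S" "card S = card V - 1"
    using ex_conn_subset[OF assms(1-3), of "card V - 1"] by auto
  have "card (V - S) = 1" using S assms by (simp add: card_Diff_subset finite_subset card_gt_0_iff Suc_leI)
  then obtain v where "V - S = {v}" by (auto simp: card_1_singleton_iff)
  then have "V - {v} = S" "v \<in> V" using S by auto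
  then show ?thesis using S by auto
qed

section \<open>Generating functions of weighted sets\<close>

definition gf :: "'c set \<Rightarrow> ('c \<Rightarrow> nat) \<Rightarrow> int fps" where
  "gf A w = Abs_fps (\<lambda>n. int (card {a \<in> A. w a = n}))"

text \<open>Since \<open>card\<close> of an infinite set is 0, the coefficients of \<open>gf\<close>
  are true counts only under this condition.\<close>

definition finite_fibres :: "'c set \<Rightarrow> ('c \<Rightarrow> nat) \<Rightarrow> bool" where
  "finite_fibres A w \<longleftrightarrow> (\<forall>n. finite {a \<in> A. w a = n})"

lemma gf_bij_betw:
  assumes "bij_betw g A B" "\<And>a. a \<in> A \<Longrightarrow> w' (g a) = w a"
  shows "gf A w = gf B w'"
proof -
  have "card {a \<in> A. w a = n} = card {b \<in> B. w' b = n}" for n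
  proof (rule bij_betw_same_card[of g])
    have "inj_on g {a \<in> A. w a = n}"
      using assms(1) by (auto simp: bij_betw_def inj_on_def)
    moreover have "g ` {a \<in> A. w a = n} = {b \<in> B. w' b = n}"
      using assms by (force simp: bij_betw_def)
    ultimately show "bij_betw g {a \<in> A. w a = n} {b \<in> B. w' b = n}"
      by (simp add: bij_betw_def)
  qed
  then show ?thesis by (simp add: gf_def)
qed

lemma finite_fibres_subset: "finite_fibres A w \<Longrightarrow> B \<subseteq> A \<Longrightarrow> finite_fibres B w"
  unfolding finite_fibres_def
proof
  fix n assume "\<forall>n. finite {a \<in> A. w a = n}" "B \<subseteq> A"
  then show "finite {a \<in> B. w a = n}"
    by (intro finite_subset[of "{a \<in> B. w a = n}" "{a \<in> A. w a = n}"]) auto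
qed

lemma gf_Un:
  assumes "finite_fibres A w" "finite_fibres B w" "A \<inter> B = {}"
  shows "gf (A \<union> B) w = gf A w + gf B w"
proof (rule fps_ext)
  fix n
  have "{a \<in> A \<union> B. w a = n} = {a \<in> A. w a = n} \<union> {a \<in> B. w a = n}" by blast
  moreover have "card ({a \<in> A. w a = n} \<union> {a \<in> B. w a = n}) = card {a \<in> A. w a = n} + card {a \<in> B. w a = n}"
    using assms by (intro card_Un_disjoint) (auto simp: finite_fibres_def)
  ultimately show "fps_nth (gf (A \<union> B) w) n = fps_nth (gf A w + gf B w) n"
    by (simp add: gf_def)
qed

lemma gf_UN:
  assumes "finite I" "\<And>i. i \<in> I \<Longrightarrow> finite_fibres (A i) w" "disjoint_family_on A I"
  shows "gf (\<Union>i\<in>I. A i) w = (\<Sum>i\<in>I. gf (A i) w)"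
proof (rule fps_ext)
  fix n
  have eq: "{a \<in> (\<Union>i\<in>I. A i). w a = n} = (\<Union>i\<in>I. {a \<in> A i. w a = n})" by blast
  have "card (\<Union>i\<in>I. {a \<in> A i. w a = n}) = (\<Sum>i\<in>I. card {a \<in> A i. w a = n})"
  proof (intro card_UN_disjoint ballI impI)
    show "finite {a \<in> A i. w a = n}" if "i \<in> I" for i
      using assms(2)[OF that] by (simp add: finite_fibres_def)
    show "{a \<in> A i. w a = n} \<inter> {a \<in> A j. w a = n} = {}" if "i \<in> I" "j \<in> I" "i \<noteq> j" for i j
    proof -
      have "A i \<inter> A j = {}" using assms(3) that by (simp add: disjoint_family_on_def)
      then show ?thesis by blast
    qed
  qed (rule assms(1))
  then show "fps_nth (gf (\<Union>i\<in>I. A i) w) n = fps_nth (\<Sum>i\<in>I. gf (A i) w) n"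
    by (simp only: gf_def eq fps_nth_Abs_fps fps_sum_nth of_nat_sum)
qed

lemma gf_times:
  assumes "finite_fibres A w" "finite_fibres B w'"
  shows "gf (A \<times> B) (\<lambda>(a, b). w a + w' b) = gf A w * gf B w'"
proof (rule fps_ext)
  fix n
  have "{p \<in> A \<times> B. (case p of (a, b) \<Rightarrow> w a + w' b) = n} =
      (\<Union>i\<in>{0..n}. {a \<in> A. w a = i} \<times> {b \<in> B. w' b = n - i})" by auto
  moreover have "card (\<Union>i\<in>{0..n}. {a \<in> A. w a = i} \<times> {b \<in> B. w' b = n - i}) =
      (\<Sum>i=0..n. card ({a \<in> A. w a = i} \<times> {b \<in> B. w' b = n - i}))"
    using assms by (intro card_UN_disjoint) (auto simp: finite_fibres_def)
  ultimately show "fps_nth (gf (A \<times> B) (\<lambda>(a, b). w a + w' b)) n = fps_nth (gf A w * gf B w') n"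
    by (simp add: gf_def fps_mult_nth card_cartesian_product)
qed

text \<open>The series \<open>1 / (1 - X)\<close>; multiplying by it forms partial sums of
  coefficients.\<close>

definition geom :: "int fps" where
  "geom = Abs_fps (\<lambda>_. 1)"

lemma gf_nat: "gf UNIV (\<lambda>k. k) = geom"
  by (simp add: gf_def geom_def)

lemma geom_mult: "geom * (1 - fps_X) = 1"
proof (rule fps_ext)
  fix n show "fps_nth (geom * (1 - fps_X)) n = fps_nth 1 n"
    by (cases n) (simp_all add: geom_def right_diff_distrib fps_mult_fps_X_commute[symmetric])
qed

lemma gf_pos: "gf {1::nat..} (\<lambda>k. k) = fps_X * geom"
proof (rule fps_ext)
  fix n :: nat
  have "{a \<in> {1..}. a = n} = (if n = 0 then {} else {n})"
    by auto
  then show "fps_nth (gf {1..} (\<lambda>k. k)) n = fps_nth (fps_X * geom) n"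
    by (simp add: gf_def geom_def)
qed

text \<open>The hockey-stick identity, as each further factor sums the coefficients. These are the
  binomials in the definition of the \<open>h\<close>*-vector.\<close>

lemma geom_power_nth: "fps_nth (geom ^ Suc d) n = int ((n + d) choose d)"
proof (induction d arbitrary: n)
  case 0
  then show ?case by (simp add: geom_def)
next
  case (Suc d)
  have "fps_nth (geom ^ Suc (Suc d)) n = (\<Sum>i=0..n. fps_nth (geom ^ Suc d) i)"
    by (subst power_Suc2) (simp add: fps_mult_nth geom_def)
  also have "\<dots> = int (\<Sum>i=0..n. (d + i) choose d)"
    unfolding Suc by (simp add: add.commute)
  also have "(\<Sum>i=0..n. (d + i) choose d) = (n + Suc d) choose Suc d"
    using choose_rising_sum(1)[of d n] by (simp add: atMost_atLeast0 add.commute)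
  finally show ?case .
qed

section \<open>Counting components of level sets\<close>

definition vecs :: "'b set \<Rightarrow> ('b \<Rightarrow> nat) set" where
  "vecs V = {x. \<forall>v. v \<notin> V \<longrightarrow> x v = 0}"

definition level :: "('b \<Rightarrow> nat) \<Rightarrow> nat \<Rightarrow> 'b set" where
  "level x j = {v. j \<le> x v}"

text \<open>The function \<open>f\<close> of the outline. Level 0 is the whole type and is left out;
  restricting to nonempty levels makes the index set finite for bounded \<open>x\<close>.\<close>

definition comp_sum :: "('b \<Rightarrow> 'b \<Rightarrow> bool) \<Rightarrow> ('b \<Rightarrow> nat) \<Rightarrow> nat" where
  "comp_sum E x = (\<Sum>j | 1 \<le> j \<and> level x j \<noteq> {}. card (comps E (level x j)))"

lemma level_subset: "x \<in> vecs V \<Longrightarrow> 1 \<le> j \<Longrightarrow> level x j \<subseteq> V"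
  unfolding vecs_def level_def by (rule subsetI, rule ccontr) simp

lemma finite_level: "finite V \<Longrightarrow> x \<in> vecs V \<Longrightarrow> 1 \<le> j \<Longrightarrow> finite (level x j)"
  by (rule finite_subset[OF level_subset])

lemma comp_sum_eq:
  assumes "\<And>v. x v \<le> N"
  shows "comp_sum E x = (\<Sum>j=1..N. card (comps E (level x j)))"
  unfolding comp_sum_def
proof (rule sum.mono_neutral_left)
  show "{j. 1 \<le> j \<and> level x j \<noteq> {}} \<subseteq> {1..N}"
    using order_trans[OF _ assms] by (auto simp: level_def)
qed auto

lemma vecs_bounded:
  assumes "finite V" "x \<in> vecs V"
  obtains N where "\<And>v. x v \<le> N"
proof
  fix v show "x v \<le> sum x V"
  proof (cases "v \<in> V")
    case True
    then show ?thesis using assms by (intro member_le_sum) auto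
  qed (use assms in \<open>auto simp: vecs_def\<close>)
qed

text \<open>Each of the levels \<open>1, ..., x v\<close> contains \<open>v\<close> and so has a
  component. This bound makes the sets to be counted finite.\<close>

lemma le_comp_sum:
  assumes "symp E" "finite V" "x \<in> vecs V"
  shows "x v \<le> comp_sum E x"
proof -
  obtain N where N: "\<And>v. x v \<le> N" using vecs_bounded assms by blast
  have "x v = (\<Sum>j=1..x v. 1)" by simp
  also have "\<dots> \<le> (\<Sum>j=1..x v. card (comps E (level x j)))"
  proof (rule sum_mono)
    fix j assume j: "j \<in> {1..x v}"
    then have "level x j \<noteq> {}" by (auto simp: level_def)
    then have "comps E (level x j) \<noteq> {}" by (rule comps_nonempty[OF assms(1)])
    moreover have "finite (comps E (level x j))"
      using finite_level[OF assms(2,3)] j by auto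
    ultimately show "1 \<le> card (comps E (level x j))" by (simp add: Suc_leI card_gt_0_iff)
  qed
  also have "\<dots> \<le> (\<Sum>j=1..N. card (comps E (level x j)))"
    using N[of v] by (intro sum_mono2) auto
  also have "\<dots> = comp_sum E x" by (rule comp_sum_eq[OF N, symmetric])
  finally show ?thesis .
qed

lemma finite_comp_sum_le:
  assumes "symp E" "finite V"
  shows "finite {x \<in> vecs V. comp_sum E x \<le> n}"
proof (rule finite_subset)
  show "{x \<in> vecs V. comp_sum E x \<le> n} \<subseteq> {f. \<forall>v. (v \<in> V \<longrightarrow> f v \<in> {..n}) \<and> (v \<notin> V \<longrightarrow> f v = 0)}"
    using le_comp_sum[OF assms] by (auto simp: vecs_def intro: order_trans)
  show "finite {f. \<forall>v. (v \<in> V \<longrightarrow> f v \<in> {..n}) \<and> (v \<notin> V \<longrightarrow> f v = (0::nat))}"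
    by (rule finite_set_of_finite_funs) (use assms in auto)
qed

lemma finite_fibres_vecs:
  assumes "symp E" "finite V"
  shows "finite_fibres (vecs V) (comp_sum E)"
  unfolding finite_fibres_def
  by (intro allI finite_subset[OF _ finite_comp_sum_le[OF assms]]) auto

definition comp_gf :: "('b \<Rightarrow> 'b \<Rightarrow> bool) \<Rightarrow> 'b set \<Rightarrow> int fps" where
  "comp_gf E V = gf (vecs V) (comp_sum E)"

section \<open>Adding a vertex whose neighbours form a clique\<close>

definition max_on :: "'b set \<Rightarrow> ('b \<Rightarrow> nat) \<Rightarrow> nat" where
  "max_on K x = Max (insert 0 (x ` K))"

text \<open>The 0 inserted in \<open>max_on\<close> covers empty \<open>K\<close>, which every
  positive level misses.\<close>

lemma level_Int_empty_iff:
  assumes "finite K" "1 \<le> i"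
  shows "level x i \<inter> K = {} \<longleftrightarrow> max_on K x < i"
proof -
  have "max_on K x < i \<longleftrightarrow> (\<forall>a\<in>K. x a < i)" using assms by (auto simp: max_on_def)
  then show ?thesis by (auto simp: level_def not_le[symmetric])
qed

lemma sum_indicator_interval:
  fixes m j N :: nat
  assumes "j \<le> N"
  shows "(\<Sum>i=1..N. if m < i \<and> i \<le> j then 1 else 0) = j - m"
proof -
  have "(\<Sum>i=1..N. if m < i \<and> i \<le> j then 1 else 0) = card ({1..N} \<inter> {i. m < i \<and> i \<le> j})"
    by (simp add: sum.If_cases)
  also have "{1..N} \<inter> {i. m < i \<and> i \<le> j} = {m<..j}" using assms by auto
  finally show ?thesis by simp
qed

text \<open>The vertex \<open>v\<close> joins the levels \<open>i \<le> m\<close>. Its neighbours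
  form a clique, so it touches at most one component there: the count stays the same if a neighbour
  is present and grows by one if the level lies above all neighbours.\<close>

lemma comp_sum_insert_simplicial:
  assumes "symp E" "finite W" "v \<notin> W" "x \<in> vecs W"
    and clique: "\<And>a b. a \<in> W \<Longrightarrow> b \<in> W \<Longrightarrow> E a v \<Longrightarrow> E b v \<Longrightarrow> a = b \<or> E a b"
  shows "comp_sum E (x(v := m)) = comp_sum E x + (m - max_on (nbrs E {v} \<inter> W) x)"
proof -
  let ?K = "nbrs E {v} \<inter> W"
  obtain N' where N': "\<And>v. x v \<le> N'" using vecs_bounded assms by blast
  define N where "N = N' + m"
  have N: "x u \<le> N" "(x(v := m)) u \<le> N" "m \<le> N" for u
    using N'[of u] by (auto simp: N_def)
  have K: "finite ?K" using assms by simp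
  have lev: "card (comps E (level (x(v := m)) i)) = card (comps E (level x i)) + (if max_on ?K x < i \<and> i \<le> m then 1 else 0)"
    if i: "i \<in> {1..N}" for i
  proof (cases "i \<le> m")
    case False
    then have "level (x(v := m)) i = level x i" using assms(3,4) i by (auto simp: level_def vecs_def)
    then show ?thesis using False by simp
  next
    case True
    let ?L = "level x i"
    have L: "?L \<subseteq> W" "finite ?L" using level_subset[OF assms(4)] finite_level[OF assms(2,4)] i by auto
    have "level (x(v := m)) i = insert v ?L" using True by (auto simp: level_def)
    moreover have "card {T \<in> comps E ?L. T \<inter> nbrs E {v} \<noteq> {}} = (if max_on ?K x < i then 0 else 1)"
    proof (cases "max_on ?K x < i")
      case True
      then have "?L \<inter> ?K = {}" using level_Int_empty_iff[OF K, of i x] i by simp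
      then have "{T \<in> comps E ?L. T \<inter> nbrs E {v} \<noteq> {}} = {}" using L compsD(1)[of _ E ?L] by blast
      then show ?thesis using True by (simp only: card.empty if_True)
    next
      case False
      then have "?L \<inter> ?K \<noteq> {}" using level_Int_empty_iff[OF K, of i x] i by simp
      then obtain a where a: "a \<in> ?L" "E a v" by (auto simp: nbrs_def)
      then obtain T where T: "T \<in> comps E ?L" "a \<in> T" using Union_comps[OF assms(1), of ?L] by blast
      have "T' = T" if T': "T' \<in> comps E ?L" "T' \<inter> nbrs E {v} \<noteq> {}" for T'
      proof -
        obtain b where b: "b \<in> T'" "E b v" using T' by (auto simp: nbrs_def)
        have "b \<in> ?L" using compsD(1)[OF T'(1)] b by blast
        then have "a = b \<or> E a b" using clique[of a b] a b L by blast
        then show ?thesis using comps_apart[OF assms(1) T(1) T'(1) _ T(2) b(1)] by blast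
      qed
      then have eq: "{T \<in> comps E ?L. T \<inter> nbrs E {v} \<noteq> {}} = {T}" using T a unfolding nbrs_def by blast
      show ?thesis unfolding eq using False by simp
    qed
    moreover have "v \<notin> ?L" using L assms(3) by blast
    ultimately show ?thesis using card_comps_insert[OF assms(1), of v ?L] L True by (auto split: if_splits)
  qed
  have "comp_sum E (x(v := m)) = (\<Sum>i=1..N. card (comps E (level (x(v := m)) i)))"
    by (rule comp_sum_eq[OF N(2)])
  also have "\<dots> = (\<Sum>i=1..N. card (comps E (level x i)) + (if max_on ?K x < i \<and> i \<le> m then 1 else 0))"
    by (rule sum.cong[OF refl lev])
  also have "\<dots> = comp_sum E x + (m - max_on ?K x)"
    unfolding sum.distrib sum_indicator_interval[OF N(3)] comp_sum_eq[OF N(1)] ..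
  finally show ?thesis .
qed

section \<open>Splitting a vector along a component of one of its levels\<close>

definition glue :: "'b set \<Rightarrow> nat \<Rightarrow> ('b \<Rightarrow> nat) \<Rightarrow> ('b \<Rightarrow> nat) \<Rightarrow> 'b \<Rightarrow> nat" where
  "glue S j y z = (\<lambda>v. if v \<in> S then j + y v else z v)"

text \<open>Up to height \<open>j\<close> a level contains all of \<open>S\<close>, and its count is
  that of the contraction, plus one once the neighbours of \<open>S\<close> have dropped out. Above
  \<open>j\<close> no neighbour of \<open>S\<close> is left, so the levels of \<open>y\<close> and
  \<open>z\<close> count separately.\<close>

lemma comp_sum_glue:
  assumes "symp E" "finite W" "S \<subseteq> W" "S \<noteq> {}" "conn E S" "y \<in> vecs S" "z \<in> vecs (W - S)"
    and j: "max_on (nbrs E S \<inter> (W - S)) z < j"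
  shows "comp_sum E (glue S j y z) =
    j - max_on (nbrs E S \<inter> (W - S)) z + comp_sum E y + comp_sum (contract E S) z"
proof -
  let ?K = "nbrs E S \<inter> (W - S)"
  let ?E = "contract E S"
  let ?x = "glue S j y z"
  have fin: "finite S" "finite (W - S)" using assms finite_subset by blast+
  obtain Ny where Ny: "\<And>v. y v \<le> Ny" using vecs_bounded fin assms by blast
  obtain Nz where Nz: "\<And>v. z v \<le> Nz" using vecs_bounded fin assms by blast
  define N where "N = j + (Ny + Nz)"
  have N: "?x u \<le> N" "z u \<le> N" "y u \<le> Ny + Nz" for u
    using Ny[of u] Nz[of u] by (auto simp: N_def glue_def)
  have K: "finite ?K" using fin by simp
  have lev: "card (comps E (level ?x i)) = card (comps ?E (level z i)) + (if max_on ?K z < i \<and> i \<le> j then 1 else 0)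
      + (if j < i then card (comps E (level y (i - j))) else 0)"
    if i: "i \<in> {1..N}" for i
  proof -
    let ?Z = "level z i"
    have Z: "?Z \<subseteq> W - S" "finite ?Z" using level_subset[OF assms(7)] finite_level[OF fin(2) assms(7)] i by auto
    have ZK: "?Z \<inter> nbrs E S = {} \<longleftrightarrow> max_on ?K z < i" using level_Int_empty_iff[OF K, of i z] i Z by auto
    show ?thesis
    proof (cases "i \<le> j")
      case True
      have "level ?x i = S \<union> ?Z" using True assms(7) i by (auto simp: level_def glue_def vecs_def)
      moreover have "S \<inter> ?Z = {}" using Z by blast
      ultimately show ?thesis
        using card_comps_Un_contract[OF assms(1,5,4), of ?Z] Z True ZK by simp
    next
      case False
      let ?Y = "level y (i - j)"
      have Y: "?Y \<subseteq> S" "finite ?Y" using level_subset[OF assms(6)] finite_level[OF fin(1) assms(6)] False by auto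
      have ZS: "?Z \<inter> nbrs E S = {}" using ZK False j by simp
      have "level ?x i = ?Y \<union> ?Z"
      proof (rule set_eqI)
        fix u show "u \<in> level ?x i \<longleftrightarrow> u \<in> ?Y \<union> ?Z"
          using False Z Y by (cases "u \<in> S") (auto simp: level_def glue_def)
      qed
      moreover have "card (comps E (?Y \<union> ?Z)) = card (comps E ?Y) + card (comps E ?Z)"
      proof (rule card_comps_Un_apart[OF assms(1)])
        show "\<not> E a b" if "a \<in> ?Y" "b \<in> ?Z" for a b
          using that ZS Y assms(1) unfolding nbrs_def by (blast dest: sympD)
      qed (use Y Z in auto)
      ultimately show ?thesis using False ZS j by (simp add: comps_contract_apart)
    qed
  qed
  have "(\<Sum>i=1..N. if j < i then card (comps E (level y (i - j))) else 0) = (\<Sum>i\<in>{j+1..j+(Ny+Nz)}. card (comps E (level y (i - j))))"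
    by (rule sum.mono_neutral_cong_right) (auto simp: N_def)
  also have "\<dots> = (\<Sum>i=1..Ny+Nz. card (comps E (level y i)))"
    by (rule sum.reindex_bij_witness[of _ "\<lambda>i. i + j" "\<lambda>i. i - j"]) auto
  also have "\<dots> = comp_sum E y" by (rule comp_sum_eq[OF N(3), symmetric])
  finally have Y: "(\<Sum>i=1..N. if j < i then card (comps E (level y (i - j))) else 0) = comp_sum E y" .
  have "comp_sum E ?x = (\<Sum>i=1..N. card (comps E (level ?x i)))"
    by (rule comp_sum_eq[OF N(1)])
  also have "\<dots> = (\<Sum>i=1..N. card (comps ?E (level z i)) + (if max_on ?K z < i \<and> i \<le> j then 1 else 0)
      + (if j < i then card (comps E (level y (i - j))) else 0))"
    by (rule sum.cong[OF refl lev])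
  also have "\<dots> = comp_sum ?E z + (j - max_on ?K z) + comp_sum E y"
    unfolding sum.distrib Y comp_sum_eq[OF N(2), symmetric]
    using sum_indicator_interval[of j N "max_on ?K z"] by (simp add: N_def)
  finally show ?thesis by simp
qed

lemma comps_level_iff:
  assumes "symp E" "finite W" "S \<subseteq> W" "x \<in> vecs W" "1 \<le> j"
  shows "S \<in> comps E (level x j) \<longleftrightarrow>
    S \<noteq> {} \<and> conn E S \<and> (\<forall>s\<in>S. j \<le> x s) \<and> max_on (nbrs E S \<inter> (W - S)) x < j"
proof -
  have K: "finite (nbrs E S \<inter> (W - S))" using assms(2) by simp
  have "(\<forall>a\<in>S. \<forall>b\<in>level x j - S. \<not> E a b) \<longleftrightarrow> level x j \<inter> (nbrs E S \<inter> (W - S)) = {}"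
    using level_subset[OF assms(4,5)] assms(1) unfolding nbrs_def by (blast dest: sympD)
  then show ?thesis using level_Int_empty_iff[OF K assms(5), of x]
    by (auto simp: comps_def level_def)
qed

text \<open>A pair \<open>(x, j)\<close> is encoded bijectively by a positive integer
  \<open>k\<close>, a vector on \<open>S\<close> and a vector on \<open>W - S\<close>, and
  \<open>comp_sum\<close> becomes additive. The range \<open>k \<ge> 1\<close> gives the factor
  \<open>fps_X * geom\<close>.\<close>

lemma gf_comp_levels:
  assumes "symp E" "finite W" "S \<subseteq> W" "S \<noteq> {}" "conn E S"
  shows "gf {(x, j). x \<in> vecs W \<and> 1 \<le> j \<and> S \<in> comps E (level x j)} (\<lambda>(x, j). comp_sum E x) =
    fps_X * geom * comp_gf E S * comp_gf (contract E S) (W - S)"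
proof -
  let ?K = "nbrs E S \<inter> (W - S)"
  let ?A = "{(x, j). x \<in> vecs W \<and> 1 \<le> j \<and> S \<in> comps E (level x j)}"
  let ?B = "({1::nat..} \<times> vecs S) \<times> vecs (W - S)"
  let ?w = "\<lambda>(p, z). (case p of (k, y) \<Rightarrow> k + comp_sum E y) + comp_sum (contract E S) z"
  \<comment> \<open>Here \<open>k\<close> is the excess of \<open>j\<close> over the highest outer
    neighbour of \<open>S\<close>, \<open>y\<close> is what \<open>x\<close> has above height
    \<open>j\<close> on \<open>S\<close>, and \<open>z\<close> is \<open>x\<close> outside
    \<open>S\<close>.\<close>
  let ?g = "\<lambda>((k, y), z). (glue S (k + max_on ?K z) y z, k + max_on ?K z)"
  let ?h = "\<lambda>(x, j). ((j - max_on ?K x, \<lambda>v. if v \<in> S then x v - j else 0), \<lambda>v. if v \<in> S then 0 else x v)"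
  have fin: "finite S" "finite (W - S)" using assms finite_subset by blast+
  have max_on_cong: "max_on ?K x = max_on ?K z" if "\<And>v. v \<notin> S \<Longrightarrow> x v = z v" for x z :: "'a \<Rightarrow> nat"
    using that by (auto simp: max_on_def intro!: arg_cong[of _ _ Max] image_cong)
  have "bij_betw ?g ?B ?A"
  proof (rule bij_betw_byWitness[of _ ?h])
    show "\<forall>p\<in>?B. ?h (?g p) = p"
    proof (clarify, goal_cases)
      case (1 k y z)
      have "max_on ?K (glue S (k + max_on ?K z) y z) = max_on ?K z" by (rule max_on_cong) (simp add: glue_def)
      then show ?case using 1 by (auto simp: glue_def vecs_def fun_eq_iff)
    qed
    show "\<forall>p\<in>?A. ?g (?h p) = p"
    proof (clarify, goal_cases)
      case (1 x j)
      have S: "\<forall>s\<in>S. j \<le> x s" "max_on ?K x < j" using comps_level_iff[OF assms(1-3) 1(1,2)] 1(3) by blast+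
      have "max_on ?K (\<lambda>v. if v \<in> S then 0 else x v) = max_on ?K x" by (rule max_on_cong) simp
      then show ?case using S by (auto simp: glue_def fun_eq_iff)
    qed
    show "?g ` ?B \<subseteq> ?A"
    proof (rule image_subsetI)
      fix p assume p: "p \<in> ?B"
      obtain k y z where pe: "p = ((k, y), z)" by (metis surj_pair)
      then have yz: "1 \<le> k" "y \<in> vecs S" "z \<in> vecs (W - S)" using p by auto
      let ?x = "glue S (k + max_on ?K z) y z"
      have x: "?x \<in> vecs W" using yz assms(3) by (auto simp: glue_def vecs_def)
      have j: "1 \<le> k + max_on ?K z" using yz by simp
      have "max_on ?K ?x = max_on ?K z" by (rule max_on_cong) (simp add: glue_def)
      then have "S \<in> comps E (level ?x (k + max_on ?K z))"
        using comps_level_iff[OF assms(1-3) x j] assms(4,5) yz(1) by (simp add: glue_def)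
      then show "?g p \<in> ?A" using x j pe by simp
    qed
    show "?h ` ?A \<subseteq> ?B"
    proof (rule image_subsetI)
      fix p assume p: "p \<in> ?A"
      obtain x j where pe: "p = (x, j)" by (metis surj_pair)
      then have xj: "x \<in> vecs W" "1 \<le> j" "S \<in> comps E (level x j)" using p by auto
      have "max_on ?K x < j" using comps_level_iff[OF assms(1-3) xj(1,2)] xj(3) by blast
      then show "?h p \<in> ?B" using xj pe by (auto simp: vecs_def)
    qed
  qed
  moreover have "(\<lambda>(x, j). comp_sum E x) (?g p) = ?w p" if "p \<in> ?B" for p
  proof -
    obtain k y z where p: "p = ((k, y), z)" by (metis surj_pair)
    then show ?thesis using that comp_sum_glue[OF assms(1-5), of y z "k + max_on ?K z"] by auto
  qed
  ultimately have "gf ?A (\<lambda>(x, j). comp_sum E x) = gf ?B ?w"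
    using gf_bij_betw[of ?g ?B ?A "\<lambda>(x, j). comp_sum E x" ?w] by simp
  also have "\<dots> = gf ({1..} \<times> vecs S) (\<lambda>(k, y). k + comp_sum E y) * comp_gf (contract E S) (W - S)"
    unfolding comp_gf_def
  proof (rule gf_times)
    show "finite_fibres (vecs (W - S)) (comp_sum (contract E S))"
      by (rule finite_fibres_vecs[OF symp_contract[OF assms(1)] fin(2)])
    show "finite_fibres ({1::nat..} \<times> vecs S) (\<lambda>(k, y). k + comp_sum E y)"
      unfolding finite_fibres_def
    proof
      fix n
      show "finite {a \<in> {1..} \<times> vecs S. (case a of (k, y) \<Rightarrow> k + comp_sum E y) = n}"
        by (rule finite_subset[of _ "{..n} \<times> {y \<in> vecs S. comp_sum E y \<le> n}"])
          (auto intro: finite_cartesian_product finite_comp_sum_le[OF assms(1) fin(1)])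
    qed
  qed
  also have "gf ({1..} \<times> vecs S) (\<lambda>(k, y). k + comp_sum E y) = fps_X * geom * comp_gf E S"
    unfolding comp_gf_def gf_pos[symmetric]
    by (rule gf_times[OF _ finite_fibres_vecs[OF assms(1) fin(1)]]) (simp add: finite_fibres_def)
  finally show ?thesis .
qed

section \<open>Gamma-positivity\<close>

text \<open>Nonnegative integer combinations of the gamma basis with centre \<open>D / 2\<close>.
  The inductive form yields closure under sums and products without coefficient bookkeeping.\<close>

inductive gamma_pos :: "nat \<Rightarrow> int fps \<Rightarrow> bool" for D where
  zero: "gamma_pos D 0"
| step: "gamma_pos D p \<Longrightarrow> 2 * i \<le> D \<Longrightarrow> gamma_pos D (p + fps_X ^ i * (1 + fps_X) ^ (D - 2 * i))"

lemma gamma_pos_monom: "2 * i \<le> D \<Longrightarrow> gamma_pos D (fps_X ^ i * (1 + fps_X) ^ (D - 2 * i))"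
  using gamma_pos.step[OF gamma_pos.zero, of i D] by simp

lemma gamma_pos_add:
  assumes "gamma_pos D p" "gamma_pos D q"
  shows "gamma_pos D (p + q)"
  using assms(2)
proof induction
  case zero
  then show ?case using assms(1) by simp
next
  case (step q i)
  then show ?case using gamma_pos.step[of D "p + q" i] by (simp add: add.assoc)
qed

lemma gamma_pos_sum: "(\<And>i. i \<in> I \<Longrightarrow> gamma_pos D (p i)) \<Longrightarrow> gamma_pos D (sum p I)"
  by (induction I rule: infinite_finite_induct) (auto intro: gamma_pos.zero gamma_pos_add)

text \<open>The product of the basis elements with indices \<open>i\<close> and \<open>j\<close> is
  the basis element with index \<open>i + j\<close> for \<open>D + D'\<close>.\<close>

lemma gamma_pos_mult:
  assumes "gamma_pos D p" "gamma_pos D' q"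
  shows "gamma_pos (D + D') (p * q)"
  using assms(1)
proof induction
  case zero
  then show ?case by (simp add: gamma_pos.zero)
next
  case (step p i)
  have "gamma_pos (D + D') (fps_X ^ i * (1 + fps_X) ^ (D - 2 * i) * q)"
    using assms(2)
  proof induction
    case zero
    then show ?case by (simp add: gamma_pos.zero)
  next
    case (step q j)
    have "D + D' - 2 * (i + j) = (D - 2 * i) + (D' - 2 * j)" using step \<open>2 * i \<le> D\<close> by simp
    then have eq: "fps_X ^ i * (1 + fps_X) ^ (D - 2 * i) * (fps_X ^ j * (1 + fps_X) ^ (D' - 2 * j)) =
        (fps_X ^ (i + j) * (1 + fps_X) ^ (D + D' - 2 * (i + j)) :: int fps)"
      by (simp add: power_add algebra_simps)
    have "2 * (i + j) \<le> D + D'" using step \<open>2 * i \<le> D\<close> by simp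
    then show ?case
      by (subst distrib_left, subst eq) (intro gamma_pos_add step.IH gamma_pos_monom)
  qed
  then show ?case unfolding distrib_right by (intro gamma_pos_add step.IH)
qed

lemma gamma_pos_1: "gamma_pos 0 1"
  using gamma_pos_monom[of 0 0] by simp

lemma gamma_pos_1_plus_X: "gamma_pos 1 (1 + fps_X)"
  using gamma_pos_monom[of 0 1] by simp

lemma gamma_pos_X: "gamma_pos 2 fps_X"
  using gamma_pos_monom[of 1 2] by simp

section \<open>Coefficients of gamma-positive series\<close>

lemma one_plus_X_power_nth: "fps_nth ((1 + fps_X) ^ m :: int fps) n = int (m choose n)"
proof (induction m arbitrary: n)
  case 0
  then show ?case by (cases n) auto
next
  case (Suc m)
  then show ?case by (cases n) (simp_all add: distrib_right)
qed

lemma gamma_monom_nth: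
  "fps_nth (fps_X ^ i * (1 + fps_X) ^ m :: int fps) n = (if n < i then 0 else int (m choose (n - i)))"
  by (simp add: fps_X_power_mult_nth one_plus_X_power_nth)

lemma gamma_pos_nth_gt: "gamma_pos D p \<Longrightarrow> D < n \<Longrightarrow> fps_nth p n = 0"
  by (induction rule: gamma_pos.induct) (auto simp: gamma_monom_nth)

lemma binomial_middle: "(2 * r + 1) choose Suc r = (2 * r + 1) choose r"
  using binomial_symmetric[of r "2 * r + 1"] by simp

lemma binomial_Suc_ge: "2 * r + 1 \<le> m \<Longrightarrow> m choose r \<le> m choose Suc r"
  using binomial_middle[of r] binomial_mono[of r "Suc r" m] by (cases "m = 2 * r + 1") auto

lemma binomial_Suc_le:
  assumes "m \<le> 2 * r + 1"
  shows "m choose Suc r \<le> m choose r"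
proof (cases "m = 2 * r + 1 \<or> m < Suc r")
  case True
  then show ?thesis using binomial_middle[of r] by (elim disjE) (simp_all add: binomial_eq_0 del: binomial_Suc_Suc)
next
  case False
  then show ?thesis using assms binomial_antimono[of r "Suc r" m] by auto
qed

text \<open>Shifting by \<open>i\<close> and lowering the exponent by \<open>2 * i\<close> keeps the
  middle at \<open>D / 2\<close>, up to which every summand increases.\<close>

lemma gamma_pos_nth_incr: "gamma_pos D p \<Longrightarrow> 2 * n + 1 \<le> D \<Longrightarrow> fps_nth p n \<le> fps_nth p (Suc n)"
proof (induction rule: gamma_pos.induct)
  case (step p i)
  have "fps_nth (fps_X ^ i * (1 + fps_X) ^ (D - 2 * i) :: int fps) n
      \<le> fps_nth (fps_X ^ i * (1 + fps_X) ^ (D - 2 * i)) (Suc n)"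
  proof (cases "n < i")
    case False
    then have "(D - 2 * i) choose (n - i) \<le> (D - 2 * i) choose (Suc n - i)"
      using step binomial_Suc_ge[of "n - i" "D - 2 * i"] by (simp add: Suc_diff_le)
    then show ?thesis using False by (simp add: gamma_monom_nth)
  qed (auto simp: gamma_monom_nth)
  then show ?case using step by simp
qed auto

lemma gamma_pos_nth_decr: "gamma_pos D p \<Longrightarrow> D \<le> 2 * n + 1 \<Longrightarrow> fps_nth p (Suc n) \<le> fps_nth p n"
proof (induction rule: gamma_pos.induct)
  case (step p i)
  \<comment> \<open>From \<open>2 * i \<le> D\<close> and \<open>D \<le> 2 * n + 1\<close> follows
    \<open>i \<le> n\<close>, so no subtraction truncates.\<close>
  have "(D - 2 * i) choose (Suc n - i) \<le> (D - 2 * i) choose (n - i)"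
    using step binomial_Suc_le[of "D - 2 * i" "n - i"] by (simp add: Suc_diff_le)
  then have "fps_nth (fps_X ^ i * (1 + fps_X) ^ (D - 2 * i) :: int fps) (Suc n)
      \<le> fps_nth (fps_X ^ i * (1 + fps_X) ^ (D - 2 * i)) n"
    using step by (simp add: gamma_monom_nth)
  then show ?case using step by simp
qed auto

section \<open>The recursion for the numerator polynomials\<close>

text \<open>The series \<open>h\<close> of the outline for the vertex set \<open>V\<close>. That it
  is a polynomial only emerges from gamma-positivity.\<close>

definition comp_numer :: "('b \<Rightarrow> 'b \<Rightarrow> bool) \<Rightarrow> 'b set \<Rightarrow> int fps" where
  "comp_numer E V = comp_gf E V * (1 - fps_X) ^ card V"

lemma max_on_le_comp_sum:
  assumes "symp E" "finite W" "x \<in> vecs W" "K \<subseteq> W"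
  shows "max_on K x \<le> comp_sum E x"
  using le_comp_sum[OF assms(1-3)] finite_subset[OF assms(4,2)] by (auto simp: max_on_def)

text \<open>Split by the value \<open>m\<close> at \<open>v\<close>. If \<open>m\<close> is at least
  the maximum over the neighbours, only the excess counts. If it is smaller, the weight is
  \<open>comp_sum E x\<close>, and \<open>(x, m)\<close> is sorted by the component of level
  \<open>m + 1\<close> that contains a neighbour of \<open>v\<close>.\<close>

lemma comp_gf_insert_simplicial:
  assumes "symp E" "finite W" "v \<notin> W"
    and clique: "\<And>a b. a \<in> W \<Longrightarrow> b \<in> W \<Longrightarrow> E a v \<Longrightarrow> E b v \<Longrightarrow> a = b \<or> E a b"
  shows "comp_gf E (insert v W) = geom * comp_gf E W +
    (\<Sum>S | S \<subseteq> W \<and> S \<noteq> {} \<and> conn E S \<and> S \<inter> nbrs E {v} \<noteq> {}. fps_X * geom * comp_gf E S * comp_gf (contract E S) (W - S))"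
    (is "_ = _ + sum _ ?I")
proof -
  let ?K = "nbrs E {v} \<inter> W"
  let ?w = "\<lambda>(x, m). comp_sum E x + (m - max_on ?K x)"
  let ?f = "\<lambda>(x, m). comp_sum E x"
  let ?P = "vecs W \<times> (UNIV :: nat set)"
  let ?A = "{(x, m). x \<in> vecs W \<and> m < max_on ?K x}"
  let ?B = "{(x, m). x \<in> vecs W \<and> max_on ?K x \<le> m}"
  let ?C = "\<lambda>S. {(x, j). x \<in> vecs W \<and> 1 \<le> j \<and> S \<in> comps E (level x j)}"
  have K: "finite ?K" "?K \<subseteq> W" using assms by auto
  have max_le: "max_on ?K x \<le> comp_sum E x" if "x \<in> vecs W" for x
    by (rule max_on_le_comp_sum[OF assms(1,2) that K(2)])
  have "comp_gf E (insert v W) = gf ?P ?w"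
    unfolding comp_gf_def
  proof (rule gf_bij_betw[symmetric])
    show "bij_betw (\<lambda>(x, m). x(v := m)) ?P (vecs (insert v W))"
      by (rule bij_betw_byWitness[of _ "\<lambda>x. (x(v := 0), x v)"])
        (use assms(3) in \<open>auto simp: vecs_def fun_eq_iff\<close>)
    show "comp_sum E ((\<lambda>(x, m). x(v := m)) p) = ?w p" if "p \<in> ?P" for p
      using comp_sum_insert_simplicial[OF assms(1-3) _ clique] that by (cases p) auto
  qed
  also have "?P = ?A \<union> ?B" by auto
  also have "gf (?A \<union> ?B) ?w = gf ?A ?w + gf ?B ?w"
  proof (rule gf_Un)
    have P: "finite_fibres ?P ?w"
      unfolding finite_fibres_def
    proof
      fix n
      \<comment> \<open>The maximum is at most \<open>comp_sum E x \<le> n\<close>, and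
        \<open>m\<close> exceeds it by at most \<open>n\<close>.\<close>
      have "m \<le> n + n" if "x \<in> vecs W" "comp_sum E x + (m - max_on ?K x) = n" for x m
        using max_le[OF that(1)] that(2) by linarith
      then show "finite {p \<in> ?P. ?w p = n}"
        by (intro finite_subset[OF _ finite_cartesian_product[OF finite_comp_sum_le[OF assms(1,2), of n] finite_atMost[of "n + n"]]])
          auto
    qed
    show "finite_fibres ?A ?w" by (rule finite_fibres_subset[OF P]) auto
    show "finite_fibres ?B ?w" by (rule finite_fibres_subset[OF P]) auto
  qed auto
  also have "gf ?B ?w = comp_gf E W * geom"
  proof -
    have "gf ?B ?w = gf ?P (\<lambda>(x, k). comp_sum E x + k)"
      by (rule gf_bij_betw[of "\<lambda>(x, m). (x, m - max_on ?K x)"],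
          rule bij_betw_byWitness[of _ "\<lambda>(x, k). (x, k + max_on ?K x)"]) auto
    also have "\<dots> = comp_gf E W * geom"
      unfolding comp_gf_def gf_nat[symmetric]
      by (rule gf_times[OF finite_fibres_vecs[OF assms(1,2)]]) (simp add: finite_fibres_def)
    finally show ?thesis .
  qed
  \<comment> \<open>The shift \<open>j = m + 1\<close> turns \<open>m < max\<close> into
    \<open>1 \<le> j \<le> max\<close>, which says that level \<open>j\<close> is a positive level
    containing a neighbour of \<open>v\<close>.\<close>
  also have "gf ?A ?w = (\<Sum>S\<in>?I. gf (?C S) ?f)"
  proof -
    have "gf ?A ?w = gf (\<Union>S\<in>?I. ?C S) ?f"
    proof (rule gf_bij_betw)
      have "(\<Union>S\<in>?I. ?C S) = {(x, j). x \<in> vecs W \<and> 1 \<le> j \<and> j \<le> max_on ?K x}"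
      proof (rule set_eqI)
        fix p :: "('a \<Rightarrow> nat) \<times> nat"
        obtain x j where p: "p = (x, j)" by (cases p)
        have "(\<exists>S\<in>?I. S \<in> comps E (level x j)) \<longleftrightarrow> j \<le> max_on ?K x" if xj: "x \<in> vecs W" "1 \<le> j"
        proof -
          have "j \<le> max_on ?K x \<longleftrightarrow> level x j \<inter> ?K \<noteq> {}"
            using level_Int_empty_iff[OF K(1) xj(2), of x] by (simp add: not_less)
          also have "\<dots> \<longleftrightarrow> level x j \<inter> nbrs E {v} \<noteq> {}" using level_subset[OF xj] by blast
          also have "\<dots> \<longleftrightarrow> (\<exists>S\<in>comps E (level x j). S \<inter> nbrs E {v} \<noteq> {})"
            by (subst Union_comps[OF assms(1), of "level x j", symmetric]) blast
          also have "\<dots> \<longleftrightarrow> (\<exists>S\<in>?I. S \<in> comps E (level x j))"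
          proof
            assume "\<exists>S\<in>comps E (level x j). S \<inter> nbrs E {v} \<noteq> {}"
            then obtain S where S: "S \<in> comps E (level x j)" "S \<inter> nbrs E {v} \<noteq> {}" by blast
            have "S \<subseteq> W" using compsD(1)[OF S(1)] level_subset[OF xj] by (rule subset_trans)
            then show "\<exists>S\<in>?I. S \<in> comps E (level x j)"
              using S compsD(2,3)[OF S(1)] by blast
          qed blast
          finally show ?thesis by simp
        qed
        then show "p \<in> (\<Union>S\<in>?I. ?C S) \<longleftrightarrow> p \<in> {(x, j). x \<in> vecs W \<and> 1 \<le> j \<and> j \<le> max_on ?K x}"
          unfolding p by auto
      qed
      then show "bij_betw (\<lambda>(x, m). (x, Suc m)) ?A (\<Union>S\<in>?I. ?C S)"
        by (simp only:) (rule bij_betw_byWitness[of _ "\<lambda>(x, m). (x, m - 1)"]; auto)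
    qed auto
    also have "\<dots> = (\<Sum>S\<in>?I. gf (?C S) ?f)"
    proof (rule gf_UN)
      show "finite ?I" by (rule finite_subset[of _ "Pow W"]) (use assms(2) in auto)
      show "finite_fibres (?C S) ?f" if S: "S \<in> ?I" for S
        unfolding finite_fibres_def
      proof
        fix n
        have "j \<le> n" if xj: "x \<in> vecs W" "S \<in> comps E (level x j)" "comp_sum E x = n" for x j
        proof -
          obtain s where "s \<in> level x j" using S compsD(1)[OF xj(2)] by blast
          then have "j \<le> x s" by (simp add: level_def)
          then show ?thesis using le_comp_sum[OF assms(1,2) xj(1), of s] xj(3) by simp
        qed
        then show "finite {p \<in> ?C S. ?f p = n}"
          by (intro finite_subset[OF _ finite_cartesian_product[OF finite_comp_sum_le[OF assms(1,2), of n] finite_atMost[of n]]])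
            auto
      qed
      \<comment> \<open>The neighbours of \<open>v\<close> form a clique, so only one component of a
        level can contain any of them.\<close>
      show "disjoint_family_on ?C ?I"
        unfolding disjoint_family_on_def
      proof (intro ballI impI)
        fix S T assume ST: "S \<in> ?I" "T \<in> ?I" "S \<noteq> T"
        have False if xj: "S \<in> comps E (level x j)" "T \<in> comps E (level x j)" for x j
        proof -
          obtain a b where ab: "a \<in> S" "E a v" "b \<in> T" "E b v" "a \<in> W" "b \<in> W"
            using ST unfolding nbrs_def by blast
          then have "a = b \<or> E a b" using clique by blast
          then show False using comps_apart[OF assms(1) xj ST(3) ab(1,3)] by blast
        qed
        then show "?C S \<inter> ?C T = {}" by blast
      qed
    qed
    finally show ?thesis .
  qed
  also have "\<dots> = (\<Sum>S\<in>?I. fps_X * geom * comp_gf E S * comp_gf (contract E S) (W - S))"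
    by (rule sum.cong[OF refl], rule gf_comp_levels[OF assms(1,2)]) auto
  finally show ?thesis by (simp add: add.commute mult.commute)
qed

text \<open>Of the \<open>card W + 1\<close> factors \<open>1 - fps_X\<close>, one cancels
  \<open>geom\<close> and the others are distributed over \<open>S\<close> and
  \<open>W - S\<close>.\<close>

lemma comp_numer_insert_simplicial:
  assumes "symp E" "finite W" "v \<notin> W"
    and clique: "\<And>a b. a \<in> W \<Longrightarrow> b \<in> W \<Longrightarrow> E a v \<Longrightarrow> E b v \<Longrightarrow> a = b \<or> E a b"
  shows "comp_numer E (insert v W) = comp_numer E W +
    (\<Sum>S | S \<subseteq> W \<and> S \<noteq> {} \<and> conn E S \<and> S \<inter> nbrs E {v} \<noteq> {}. fps_X * (comp_numer E S * comp_numer (contract E S) (W - S)))"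
    (is "_ = _ + sum _ ?I")
proof -
  let ?q = "1 - fps_X :: int fps"
  have "comp_numer E (insert v W) = comp_gf E (insert v W) * (?q * ?q ^ card W)"
    using assms by (simp add: comp_numer_def)
  also have "\<dots> = (geom * ?q) * (comp_gf E W * ?q ^ card W) +
      (\<Sum>S\<in>?I. (geom * ?q) * (fps_X * comp_gf E S * comp_gf (contract E S) (W - S) * ?q ^ card W))"
    by (subst comp_gf_insert_simplicial[OF assms], assumption+)
      (simp only: distrib_right sum_distrib_right, simp only: mult_ac)
  also have "\<dots> = comp_numer E W + (\<Sum>S\<in>?I. fps_X * comp_gf E S * comp_gf (contract E S) (W - S) * ?q ^ card W)"
    by (simp add: geom_mult comp_numer_def)
  also have "(\<Sum>S\<in>?I. fps_X * comp_gf E S * comp_gf (contract E S) (W - S) * ?q ^ card W) =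
      (\<Sum>S\<in>?I. fps_X * (comp_numer E S * comp_numer (contract E S) (W - S)))"
  proof (rule sum.cong[OF refl])
    fix S assume "S \<in> ?I"
    then have "S \<subseteq> W" by blast
    then have "card W = card S + card (W - S)"
      using assms(2) by (metis add.commute card_Diff_subset card_mono finite_subset le_add_diff_inverse2)
    then show "fps_X * comp_gf E S * comp_gf (contract E S) (W - S) * ?q ^ card W = fps_X * (comp_numer E S * comp_numer (contract E S) (W - S))"
      by (simp add: comp_numer_def power_add mult_ac)
  qed
  finally show ?thesis .
qed

lemma comp_sum_zero: "comp_sum E (\<lambda>_. 0) = 0"
  by (simp add: comp_sum_def level_def)

lemma comp_gf_empty: "comp_gf E {} = 1"
proof (rule fps_ext)
  fix n
  have "vecs {} = {\<lambda>_::'a. 0::nat}" by (auto simp: vecs_def)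
  then have "{x \<in> vecs {}. comp_sum E x = n} = (if n = 0 then {\<lambda>_. 0} else {})"
    by (auto simp: comp_sum_zero)
  then show "fps_nth (comp_gf E {}) n = fps_nth 1 n"
    by (simp add: comp_gf_def gf_def)
qed

lemma comp_numer_empty: "comp_numer E {} = 1"
  by (simp add: comp_numer_def comp_gf_empty)

text \<open>Strong induction, removing a non-cut vertex \<open>v\<close>. The neighbours of
  \<open>v\<close> lie in the connected set \<open>W\<close>, so by the block graph property they
  form a clique and the recursion applies.\<close>

theorem gamma_pos_comp_numer_conn:
  assumes "finite V" "block_graph E V" "conn E V" "V \<noteq> {}"
  shows "gamma_pos (card V - 1) (comp_numer E V)"
  using assms
\<comment> \<open>The relation is generalised too, since the recursion also involves contracted
  graphs.\<close>
proof (induction "card V" arbitrary: V E rule: less_induct)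
  case less
  have sE: "symp E" using less.prems(2) by (rule block_graph_symp)
  obtain v where v: "v \<in> V" "conn E (V - {v})" using ex_noncut_vertex[OF sE] less.prems by blast
  define W where "W = V - {v}"
  have W: "v \<notin> W" "finite W" "V = insert v W" "conn E W" "card V = Suc (card W)" "W \<subseteq> V"
    using v less.prems(1) card_Suc_Diff1[OF less.prems(1) v(1)] by (auto simp: W_def)
  have bW: "block_graph E W" using block_graph_subset less.prems(2) W(6) by blast
  let ?I = "{S. S \<subseteq> W \<and> S \<noteq> {} \<and> conn E S \<and> S \<inter> nbrs E {v} \<noteq> {}}"
  let ?t = "\<lambda>S. fps_X * (comp_numer E S * comp_numer (contract E S) (W - S))"
  have fI: "finite ?I" by (rule finite_subset[of _ "Pow W"]) (use W(2) in auto)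
  have rec: "comp_numer E V = comp_numer E W + sum ?t ?I"
    unfolding W(3)
    by (rule comp_numer_insert_simplicial[OF sE W(2,1)]) (rule block_graphD[OF less.prems(2) W(6,4) v(1) W(1)])
  show ?case
  proof (cases "W = {}")
    case True
    then have "?I = {}" by blast
    then have "comp_numer E V = 1" using rec True by (simp only: comp_numer_empty sum.empty add_0_right)
    then show ?thesis using W(5) True gamma_pos_1 by simp
  next
    case False
    have cW: "0 < card W" using False W(2) by (simp add: card_gt_0_iff)
    have HW: "gamma_pos (card W - 1) (comp_numer E W)"
      using less.hyps[OF _ W(2) bW W(4) False] W(5) by simp
    obtain a b where "a \<in> W" "b \<in> V - W" "E a b"
      using connD[OF less.prems(3) W(6) False] W(1,3) by blast
    then have "W \<inter> nbrs E {v} \<noteq> {}" using W(3) by (auto simp: nbrs_def)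
    then have WI: "W \<in> ?I" using W(4) False by blast
    \<comment> \<open>The term for \<open>S = W\<close> leaves the empty set after contraction,
      whose numerator is 1; together with the first term it gives the factor
      \<open>1 + fps_X\<close>.\<close>
    have "comp_numer E V = comp_numer E W + (?t W + sum ?t (?I - {W}))"
      unfolding rec by (simp add: sum.remove[OF fI WI])
    also have "\<dots> = (1 + fps_X) * comp_numer E W + sum ?t (?I - {W})"
      by (simp add: comp_numer_empty algebra_simps)
    finally have eq: "comp_numer E V = (1 + fps_X) * comp_numer E W + sum ?t (?I - {W})" .
    have "gamma_pos (card W) ((1 + fps_X) * comp_numer E W)"
      using gamma_pos_mult[OF gamma_pos_1_plus_X HW] cW by simp
    moreover have "gamma_pos (card W) (sum ?t (?I - {W}))"
    proof (rule gamma_pos_sum)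
      fix S assume S: "S \<in> ?I - {W}"
      then have S': "S \<subset> W" "S \<noteq> {}" "conn E S" "S \<subseteq> W" "finite S" using W(2) finite_subset by blast+
      have "card S < card W" using S'(1) W(2) by (rule psubset_card_mono[rotated])
      have c: "card (W - S) = card W - card S" using S'(4,5) by (simp add: card_Diff_subset)
      have pos: "0 < card S" using S'(2,5) by (simp add: card_gt_0_iff)
      have "gamma_pos (card S - 1) (comp_numer E S)"
        using less.hyps[OF _ S'(5) block_graph_subset[OF bW S'(4)] S'(3,2)] \<open>card S < card W\<close> W(5) by simp
      moreover have "gamma_pos (card (W - S) - 1) (comp_numer (contract E S) (W - S))"
      proof (rule less.hyps)
        show "card (W - S) < card V" using c W(5) by simp
        show "W - S \<noteq> {}" using S'(1) by blast
      qed (use W(2) block_graph_contract[OF bW S'(4,3)] conn_contract[OF sE W(4) S'(4,2)] in auto)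
      ultimately have "gamma_pos (2 + (card S - 1 + (card (W - S) - 1))) (?t S)"
        by (intro gamma_pos_mult gamma_pos_X)
      \<comment> \<open>The factor \<open>fps_X\<close> has parameter 2, which makes up for the two
        losses of 1; all terms thus have the same centre.\<close>
      moreover have "2 + (card S - 1 + (card (W - S) - 1)) = card W"
        using c pos \<open>card S < card W\<close> by simp
      ultimately show "gamma_pos (card W) (?t S)" by simp
    qed
    ultimately show ?thesis unfolding eq using W(5) gamma_pos_add by simp
  qed
qed

section \<open>Multiplicativity over nonadjacent parts\<close>

lemma comp_sum_apart:
  assumes "symp E" "finite S" "finite T" "S \<inter> T = {}" "\<And>a b. a \<in> S \<Longrightarrow> b \<in> T \<Longrightarrow> \<not> E a b"
    and "y \<in> vecs S" "z \<in> vecs T"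
  shows "comp_sum E (glue S 0 y z) = comp_sum E y + comp_sum E z"
proof -
  obtain Ny where Ny: "\<And>v. y v \<le> Ny" using vecs_bounded assms(2,6) by blast
  obtain Nz where Nz: "\<And>v. z v \<le> Nz" using vecs_bounded assms(3,7) by blast
  have N: "glue S 0 y z v \<le> Ny + Nz" "y v \<le> Ny + Nz" "z v \<le> Ny + Nz" for v
    using Ny[of v] Nz[of v] by (auto simp: glue_def)
  have lev: "card (comps E (level (glue S 0 y z) i)) = card (comps E (level y i)) + card (comps E (level z i))"
    if i: "i \<in> {1..Ny + Nz}" for i
  proof -
    have i1: "1 \<le> i" using i by simp
    note Y = level_subset[OF assms(6) i1] finite_level[OF assms(2,6) i1]
    note Z = level_subset[OF assms(7) i1] finite_level[OF assms(3,7) i1]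
    have "level (glue S 0 y z) i = level y i \<union> level z i"
    proof (rule set_eqI)
      fix u show "u \<in> level (glue S 0 y z) i \<longleftrightarrow> u \<in> level y i \<union> level z i"
        using Y Z assms(4) by (cases "u \<in> S") (auto simp: level_def glue_def)
    qed
    then show ?thesis
      using card_comps_Un_apart[OF assms(1), of "level y i" "level z i"] Y Z assms(4,5)
      by (metis disjoint_iff subsetD)
  qed
  show ?thesis
    unfolding comp_sum_eq[OF N(1)] comp_sum_eq[OF N(2)] comp_sum_eq[OF N(3)] sum.distrib[symmetric]
    by (rule sum.cong[OF refl lev])
qed

lemma comp_numer_apart:
  assumes "symp E" "finite S" "finite T" "S \<inter> T = {}" "\<And>a b. a \<in> S \<Longrightarrow> b \<in> T \<Longrightarrow> \<not> E a b"
  shows "comp_numer E (S \<union> T) = comp_numer E S * comp_numer E T"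
proof -
  have "gf (vecs S \<times> vecs T) (\<lambda>(y, z). comp_sum E y + comp_sum E z) = comp_gf E (S \<union> T)"
    unfolding comp_gf_def
  proof (rule gf_bij_betw)
    show "bij_betw (\<lambda>(y, z). glue S 0 y z) (vecs S \<times> vecs T) (vecs (S \<union> T))"
      by (rule bij_betw_byWitness[of _ "\<lambda>x. (\<lambda>v. if v \<in> S then x v else 0, \<lambda>v. if v \<in> S then 0 else x v)"])
        (use assms(4) in \<open>auto simp: vecs_def glue_def fun_eq_iff\<close>)
    show "comp_sum E ((\<lambda>(y, z). glue S 0 y z) p) = (\<lambda>(y, z). comp_sum E y + comp_sum E z) p"
      if "p \<in> vecs S \<times> vecs T" for p
      using comp_sum_apart[OF assms] that by (cases p) auto
  qed
  then have "comp_gf E (S \<union> T) = comp_gf E S * comp_gf E T"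
    using gf_times[OF finite_fibres_vecs[OF assms(1,2)] finite_fibres_vecs[OF assms(1,3)]]
    by (simp add: comp_gf_def)
  then show ?thesis using assms(2-4) by (simp add: comp_numer_def card_Un_disjoint power_add mult_ac)
qed

text \<open>Peel off one component at a time: numerators multiply and the parameters add. A
  component \<open>S\<close> contributes \<open>card S - 1\<close>, hence the bound on
  \<open>D\<close>.\<close>

theorem gamma_pos_comp_numer:
  assumes "finite V" "block_graph E V"
  shows "\<exists>D\<le>card V. gamma_pos D (comp_numer E V)"
  using assms
proof (induction "card V" arbitrary: V rule: less_induct)
  case less
  have sE: "symp E" using less.prems(2) by (rule block_graph_symp)
  show ?case
  proof (cases "V = {}")
    case True
    then show ?thesis using gamma_pos_1 by (auto simp: comp_numer_empty)
  next
    case False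
    then obtain S where S: "S \<in> comps E V" using comps_nonempty[OF sE] by blast
    note S' = compsD[OF S]
    have fS: "finite S" using finite_subset[OF S'(1) less.prems(1)] .
    have c: "card V = card S + card (V - S)" "0 < card S"
      using S'(1,2) fS less.prems(1) by (simp_all add: card_Diff_subset card_mono card_gt_0_iff)
    obtain D where D: "D \<le> card (V - S)" "gamma_pos D (comp_numer E (V - S))"
      using less.hyps[of "V - S"] less.prems c block_graph_subset[OF less.prems(2), of "V - S"] by auto
    have "gamma_pos (card S - 1) (comp_numer E S)"
      by (rule gamma_pos_comp_numer_conn[OF fS block_graph_subset[OF less.prems(2) S'(1)] S'(3,2)])
    from gamma_pos_mult[OF this D(2)] have "gamma_pos (card S - 1 + D) (comp_numer E S * comp_numer E (V - S))" .
    also have "comp_numer E S * comp_numer E (V - S) = comp_numer E V"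
      using comp_numer_apart[OF sE fS, of "V - S"] S'(1,4) less.prems(1) by (simp add: Un_absorb1)
    finally show ?thesis using D(1) c by (intro exI[of _ "card S - 1 + D"]) auto
  qed
qed

section \<open>Supporting functionals\<close>

text \<open>Send a component of \<open>A\<close> to the component of \<open>V - {v}\<close>
  containing it. Two touching components with the same image would have neighbours of
  \<open>v\<close> in one connected set avoiding \<open>v\<close>; these are equal or adjacent, so
  the two components agree.\<close>

lemma card_comps_touching_mono:
  assumes "block_graph E V" "finite V" "v \<in> V" "A \<subseteq> V - {v}"
  shows "card {T \<in> comps E A. T \<inter> nbrs E {v} \<noteq> {}} \<le> card {T \<in> comps E (V - {v}). T \<inter> nbrs E {v} \<noteq> {}}"
proof -
  have sE: "symp E" using assms(1) by (rule block_graph_symp)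
  let ?W = "V - {v}"
  have ex: "\<exists>S. S \<in> comps E ?W \<and> T \<subseteq> S" if T: "T \<in> comps E A" for T
  proof -
    have TW: "T \<subseteq> ?W" using compsD(1)[OF T] assms(4) by (rule subset_trans)
    obtain t where t: "t \<in> T" using compsD(2)[OF T] by blast
    then obtain S where S: "S \<in> comps E ?W" "t \<in> S" using Union_comps[OF sE, of ?W] TW by blast
    then have "T \<subseteq> S" using conn_subset_comp[OF sE S(1) TW compsD(3)[OF T]] t by blast
    then show ?thesis using S by blast
  qed
  define g where "g T = (SOME S. S \<in> comps E ?W \<and> T \<subseteq> S)" for T
  have g: "g T \<in> comps E ?W" "T \<subseteq> g T" if "T \<in> comps E A" for T
    using someI_ex[OF ex[OF that]] by (simp_all add: g_def)
  show ?thesis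
  proof (rule card_inj_on_le[of g])
    show "inj_on g {T \<in> comps E A. T \<inter> nbrs E {v} \<noteq> {}}"
    proof (rule inj_onI)
      fix S T
      assume S0: "S \<in> {T \<in> comps E A. T \<inter> nbrs E {v} \<noteq> {}}" and T0: "T \<in> {T \<in> comps E A. T \<inter> nbrs E {v} \<noteq> {}}"
        and eq: "g S = g T"
      have S: "S \<in> comps E A" and T: "T \<in> comps E A" using S0 T0 by blast+
      obtain a b where ab: "a \<in> S" "E a v" "b \<in> T" "E b v" using S0 T0 unfolding nbrs_def by blast
      have "a \<in> g S" "b \<in> g S" using g(2)[OF S] g(2)[OF T] eq ab by auto
      moreover have "g S \<subseteq> V" "v \<notin> g S" "conn E (g S)" using compsD(1,3)[OF g(1)[OF S]] by blast+
      ultimately have "a = b \<or> E a b" using block_graphD[OF assms(1)] assms(3) ab by metis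
      then show "S = T" using comps_apart[OF sE S T _ ab(1,3)] by blast
    qed
    show "g ` {T \<in> comps E A. T \<inter> nbrs E {v} \<noteq> {}} \<subseteq> {T \<in> comps E ?W. T \<inter> nbrs E {v} \<noteq> {}}"
    proof (rule image_subsetI)
      fix T assume T: "T \<in> {T \<in> comps E A. T \<inter> nbrs E {v} \<noteq> {}}"
      then have TA: "T \<in> comps E A" by blast
      show "g T \<in> {T \<in> comps E ?W. T \<inter> nbrs E {v} \<noteq> {}}" using g[OF TA] T by blast
    qed
  qed (use assms(2) in simp)
qed

text \<open>Convexity of the component count: the increments along the decreasing order of the values of
  \<open>x\<close> define a linear functional that is tight at \<open>x\<close>.\<close>

lemma supporting_functional:
  assumes "finite V" "block_graph E V" "x \<in> vecs V"
  shows "\<exists>l :: 'b \<Rightarrow> int. (\<forall>A\<subseteq>V. sum l A \<le> int (card (comps E A))) \<and>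
    (\<Sum>v\<in>V. l v * int (x v)) = int (comp_sum E x)"
  using assms
proof (induction "card V" arbitrary: V x rule: less_induct)
  case less
  have sE: "symp E" using less.prems(2) by (rule block_graph_symp)
  show ?case
  proof (cases "V = {}")
    case True
    then have "x = (\<lambda>_. 0)" using less.prems(3) by (auto simp: vecs_def)
    then show ?thesis using True by (auto simp: comp_sum_zero)
  next
    case False
    \<comment> \<open>A vertex of least value is the last one in decreasing order.\<close>
    have "\<exists>v\<in>V. \<forall>u\<in>V. x v \<le> x u"
      using ex_min_if_finite[of "x ` V"] less.prems(1) False by (auto simp: not_less)
    then obtain v where v: "v \<in> V" "\<And>u. u \<in> V \<Longrightarrow> x v \<le> x u" by blast
    define W where "W = V - {v}"
    have W: "finite W" "v \<notin> W" "V = insert v W" "card W < card V"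
      using v(1) less.prems(1) card_Diff1_less[OF less.prems(1) v(1)] by (auto simp: W_def simp del: card_Diff_singleton)
    have bW: "block_graph E W" using block_graph_subset[OF less.prems(2)] W(3) by blast
    define x' where "x' = x(v := 0)"
    have x': "x' \<in> vecs W" using less.prems(3) by (auto simp: x'_def vecs_def W_def)
    obtain l where l: "\<And>A. A \<subseteq> W \<Longrightarrow> sum l A \<le> int (card (comps E A))"
      "(\<Sum>u\<in>W. l u * int (x' u)) = int (comp_sum E x')"
      using less.hyps[OF W(4,1) bW x'] by blast
    define t where "t = card {T \<in> comps E W. T \<inter> nbrs E {v} \<noteq> {}}"
    \<comment> \<open>The value \<open>1 - t\<close> is the change of the component count when
      \<open>v\<close> joins all of \<open>W\<close>.\<close>
    define l' where "l' = l(v := 1 - int t)"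
    have l'W: "sum l' A = sum l A" if "A \<subseteq> W" for A
      using that W(2) by (intro sum.cong) (auto simp: l'_def)
    have "sum l' A \<le> int (card (comps E A))" if A: "A \<subseteq> V" for A
    proof (cases "v \<in> A")
      case False
      then have "A \<subseteq> W" using A W(3) by blast
      then show ?thesis using l(1) l'W by simp
    next
      case True
      define A' where "A' = A - {v}"
      have A': "A = insert v A'" "v \<notin> A'" "A' \<subseteq> W" "finite A'"
        using True A W finite_subset by (auto simp: A'_def intro: finite_subset)
      have "int (card (comps E A)) + int (card {T \<in> comps E A'. T \<inter> nbrs E {v} \<noteq> {}}) = 1 + int (card (comps E A'))"
        using card_comps_insert[OF sE A'(2,4)] A'(1) by simp
      \<comment> \<open>Joining the smaller set \<open>A'\<close> touches no more components, so the
        count changes by at least \<open>1 - t\<close>.\<close>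
      moreover have "card {T \<in> comps E A'. T \<inter> nbrs E {v} \<noteq> {}} \<le> t"
        using card_comps_touching_mono[OF less.prems(2,1) v(1)] A'(3) by (simp add: t_def W_def)
      moreover have "sum l' A = (1 - int t) + sum l A'"
        using A' l'W[OF A'(3)] by (simp add: l'_def)
      ultimately show ?thesis using l(1)[OF A'(3)] by linarith
    qed
    moreover have "(\<Sum>u\<in>V. l' u * int (x u)) = int (comp_sum E x)"
    proof -
      obtain N where N: "\<And>u. x u \<le> N" using vecs_bounded less.prems(1,3) by blast
      have N': "x' u \<le> N" for u using N[of u] by (simp add: x'_def)
      have lev: "int (card (comps E (level x j))) = int (card (comps E (level x' j))) + (if j \<le> x v then 1 - int t else 0)"
        if j: "j \<in> {1..N}" for j
      proof (cases "j \<le> x v")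
        case False
        then have "level x j = level x' j" using j by (auto simp: level_def x'_def)
        then show ?thesis using False by simp
      next
        case True
        \<comment> \<open>By minimality of \<open>x v\<close>, every level up to height
          \<open>x v\<close> is all of \<open>V\<close>; setting the value at \<open>v\<close> to 0
          turns it into \<open>W\<close>.\<close>
        have "level x j = V"
          using level_subset[OF less.prems(3), of j] j True v(2) order_trans by (fastforce simp: level_def)
        moreover have "level x' j = W"
          using level_subset[OF x', of j] j True v(2) W(3) order_trans W(2) by (fastforce simp: level_def x'_def)
        ultimately show ?thesis using card_comps_insert[OF sE W(2,1)] True W(3) by (simp add: t_def)
      qed
      have "int (comp_sum E x) = (\<Sum>j=1..N. int (card (comps E (level x j))))"
        by (simp add: comp_sum_eq[OF N])
      also have "\<dots> = (\<Sum>j=1..N. int (card (comps E (level x' j)))) + (\<Sum>j=1..N. if j \<le> x v then 1 - int t else 0)"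
        unfolding sum.distrib[symmetric] by (rule sum.cong[OF refl lev])
      also have "(\<Sum>j=1..N. int (card (comps E (level x' j)))) = int (comp_sum E x')"
        by (simp add: comp_sum_eq[OF N'])
      also have "(\<Sum>j=1..N. if j \<le> x v then 1 - int t else 0) = (\<Sum>j=1..x v. 1 - int t)"
        using N[of v] by (intro sum.mono_neutral_cong_right) auto
      also have "\<dots> = l' v * int (x v)" by (simp add: l'_def)
      also have "int (comp_sum E x') = (\<Sum>u\<in>W. l' u * int (x u))"
        unfolding l(2)[symmetric] by (rule sum.cong) (use W(2) in \<open>auto simp: l'_def x'_def\<close>)
      finally show ?thesis using W by (simp add: add.commute)
    qed
    ultimately show ?thesis by blast
  qed
qed

section \<open>Reading off the \<open>h\<^sup>*\<close>-vector\<close>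

text \<open>At argument \<open>n\<close> the binomials with \<open>i > n\<close> vanish and the one
  with \<open>i = n\<close> is 1, so the entries are determined one after another.\<close>

lemma is_hstar_vector_unique:
  assumes "is_hstar_vector P h" "is_hstar_vector P h'"
  shows "h = h'"
proof -
  define d where "d = nat (aff_dim P)"
  have len: "length h = d + 1" "length h' = d + 1"
    and eq: "(\<Sum>i=0..d. h ! i * int ((n + d - i) choose d)) = (\<Sum>i=0..d. h' ! i * int ((n + d - i) choose d))" for n
    using assms by (simp_all add: is_hstar_vector_def Let_def d_def)
  have "h ! n = h' ! n" if "n \<le> d" for n
    using that
  proof (induction n rule: less_induct)
    case (less n)
    have "(\<Sum>i\<in>{0..d} - {n}. h ! i * int ((n + d - i) choose d)) = (\<Sum>i\<in>{0..d} - {n}. h' ! i * int ((n + d - i) choose d))"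
    proof (rule sum.cong[OF refl])
      fix i assume i: "i \<in> {0..d} - {n}"
      show "h ! i * int ((n + d - i) choose d) = h' ! i * int ((n + d - i) choose d)"
      proof (cases "i < n")
        case True
        then show ?thesis using less i by simp
      next
        case False
        then have "n + d - i < d" using i by auto
        then show ?thesis by simp
      qed
    qed
    moreover have "n \<in> {0..d}" using less.prems by simp
    ultimately show ?case using eq[of n] by (simp add: sum.remove[of "{0..d}" n])
  qed
  then show ?thesis using len by (intro nth_equalityI) auto
qed

text \<open>The hypotheses state that the Ehrhart series is \<open>p / (1 - X)^(d + 1)\<close> with
  \<open>p\<close> of degree at most \<open>d\<close>; its coefficients are the defining
  identity.\<close>

lemma hstar_vector_eqI:
  assumes "\<And>n. int (ehrhart_count P n) = fps_nth (p * geom ^ Suc (nat (aff_dim P))) n"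
    and "\<And>i. nat (aff_dim P) < i \<Longrightarrow> fps_nth p i = 0"
  shows "hstar_vector P = map (fps_nth p) [0..<Suc (nat (aff_dim P))]"
proof -
  define d where "d = nat (aff_dim P)"
  have "int (ehrhart_count P n) = (\<Sum>i=0..d. fps_nth p i * int ((n + d - i) choose d))" for n
  proof -
    have "int (ehrhart_count P n) = (\<Sum>i=0..n. fps_nth p i * int ((n - i + d) choose d))"
      unfolding assms(1) d_def[symmetric] fps_mult_nth geom_power_nth ..
    also have "\<dots> = (\<Sum>i=0..n. fps_nth p i * int ((n + d - i) choose d))"
      by (rule sum.cong) auto
    also have "\<dots> = (\<Sum>i\<in>{0..n} \<inter> {0..d}. fps_nth p i * int ((n + d - i) choose d))"
      by (rule sum.mono_neutral_right) (use assms(2) in \<open>auto simp: d_def\<close>)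
    also have "\<dots> = (\<Sum>i=0..d. fps_nth p i * int ((n + d - i) choose d))"
      by (rule sum.mono_neutral_left) auto
    finally show ?thesis .
  qed
  then have "is_hstar_vector P (map (fps_nth p) [0..<Suc d])"
    unfolding is_hstar_vector_def Let_def d_def[symmetric]
    by (auto simp del: upt_Suc simp: nth_map_upt intro!: sum.cong)
  then show ?thesis
    unfolding hstar_vector_def d_def using is_hstar_vector_unique by (blast intro: the_equality)
qed

text \<open>The peak sits at \<open>D div 2\<close>. For \<open>D < d\<close> the list ends in
  zeros, which the descending half covers.\<close>

lemma unimodal_gamma_pos:
  assumes "gamma_pos D p" "D \<le> d"
  shows "unimodal (map (fps_nth p) [0..<Suc d])"
  unfolding unimodal_def
proof (intro exI[of _ "D div 2"] conjI allI impI)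
  show "D div 2 < length (map (fps_nth p) [0..<Suc d])" using assms(2) by simp
  show "map (fps_nth p) [0..<Suc d] ! i \<le> map (fps_nth p) [0..<Suc d] ! Suc i" if "i < D div 2" for i
    using gamma_pos_nth_incr[OF assms(1), of i] that assms(2) by (simp del: upt_Suc add: nth_map_upt)
  show "map (fps_nth p) [0..<Suc d] ! Suc i \<le> map (fps_nth p) [0..<Suc d] ! i"
    if i: "D div 2 \<le> i \<and> Suc i < length (map (fps_nth p) [0..<Suc d])" for i
  proof -
    have "D \<le> 2 * i + 1" using i by linarith
    then show ?thesis using gamma_pos_nth_decr[OF assms(1), of i] i assms(2) by (simp del: upt_Suc add: nth_map_upt)
  qed
qed

text \<open>All but one factor \<open>geom\<close> cancel against the numerator's powers of
  \<open>1 - fps_X\<close>; the last one turns counts of \<open>= n\<close> into counts of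
  \<open>\<le> n\<close>.\<close>

lemma card_comp_sum_le:
  assumes "symp E" "finite V"
  shows "int (card {x \<in> vecs V. comp_sum E x \<le> n}) = fps_nth (comp_numer E V * geom ^ Suc (card V)) n"
proof -
  have "comp_numer E V * geom ^ Suc (card V) = comp_gf E V * geom * (geom * (1 - fps_X)) ^ card V"
    by (simp add: comp_numer_def power_mult_distrib mult_ac)
  also have "\<dots> = comp_gf E V * geom" by (simp add: geom_mult)
  finally have "fps_nth (comp_numer E V * geom ^ Suc (card V)) n = fps_nth (comp_gf E V * geom) n" by (rule arg_cong)
  also have "\<dots> = (\<Sum>i=0..n. int (card {x \<in> vecs V. comp_sum E x = i}))"
    by (simp add: fps_mult_nth geom_def comp_gf_def gf_def)
  also have "\<dots> = int (card (\<Union>i\<in>{0..n}. {x \<in> vecs V. comp_sum E x = i}))"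
    using finite_fibres_vecs[OF assms] by (subst card_UN_disjoint) (auto simp: finite_fibres_def)
  also have "(\<Union>i\<in>{0..n}. {x \<in> vecs V. comp_sum E x = i}) = {x \<in> vecs V. comp_sum E x \<le> n}"
    by auto
  finally show ?thesis by simp
qed

section \<open>Blocks of a graph\<close>

definition edge_rel :: "'a graph \<Rightarrow> ('a \<times> 'a) set" where
  "edge_rel G = {(x, y). {x, y} \<in> edges G}"

lemma connected_graph_iff:
  "connected_graph G \<longleftrightarrow> (\<forall>u\<in>verts G. \<forall>v\<in>verts G. (u, v) \<in> (edge_rel G)\<^sup>*)"
  by (simp add: connected_graph_def reachability_def edge_rel_def)

lemma edge_rel_rtrancl_sym: "(u, v) \<in> (edge_rel G)\<^sup>* \<Longrightarrow> (v, u) \<in> (edge_rel G)\<^sup>*"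
  by (rule symD[OF sym_rtrancl]) (auto simp: sym_def edge_rel_def insert_commute)

lemma edge_rel_rtrancl_mono: "edges G \<subseteq> edges H \<Longrightarrow> (u, v) \<in> (edge_rel G)\<^sup>* \<Longrightarrow> (u, v) \<in> (edge_rel H)\<^sup>*"
  by (rule rtrancl_mono[THEN subsetD, of "edge_rel G"]) (auto simp: edge_rel_def)

lemma connected_graph_hub:
  assumes "\<And>u. u \<in> verts G \<Longrightarrow> (u, h) \<in> (edge_rel G)\<^sup>*"
  shows "connected_graph G"
  unfolding connected_graph_iff using assms edge_rel_rtrancl_sym rtrancl_trans by metis

lemma simple_graphD:
  assumes "simple_graph G" "e \<in> edges G"
  shows "e \<subseteq> verts G" "card e = 2"
  using assms by (auto simp: simple_graph_def)

text \<open>Treats 2-connected subgraphs and single edges uniformly, so that both kinds of blocks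
  become maximal objects of one kind. Deleting a non-vertex changes nothing in a simple graph, hence
  \<open>v\<close> may be arbitrary.\<close>

definition nonseparable_subgraph :: "'a graph \<Rightarrow> 'a graph \<Rightarrow> bool" where
  "nonseparable_subgraph G H \<longleftrightarrow> subgraph H G \<and> 2 \<le> card (verts H) \<and> connected_graph H \<and>
     (\<forall>v. connected_graph (delete_vertex v H))"

lemma delete_vertex_notin: "simple_graph H \<Longrightarrow> v \<notin> verts H \<Longrightarrow> delete_vertex v H = H"
  by (auto simp: delete_vertex_def simple_graph_def prod_eq_iff)

lemma two_connected_iff:
  assumes "subgraph H G"
  shows "two_connected H \<longleftrightarrow> nonseparable_subgraph G H \<and> 3 \<le> card (verts H)"
proof -
  have "simple_graph H" using assms by (simp add: subgraph_def)
  then have "(\<forall>v\<in>verts H. connected_graph (delete_vertex v H)) \<longleftrightarrow> (\<forall>v. connected_graph (delete_vertex v H))"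
    if "connected_graph H"
    using that delete_vertex_notin by metis
  then show ?thesis using assms by (auto simp: two_connected_def nonseparable_subgraph_def)
qed

lemma graph_Union_pair: "graph_Union {A, B} = (verts A \<union> verts B, edges A \<union> edges B)"
  by (simp add: graph_Union_def)

lemma connected_graph_Union_pair:
  assumes "connected_graph A" "connected_graph B" "h \<in> verts A" "h \<in> verts B"
  shows "connected_graph (graph_Union {A, B})"
proof (rule connected_graph_hub)
  fix u assume "u \<in> verts (graph_Union {A, B})"
  then have "(u, h) \<in> (edge_rel A)\<^sup>* \<or> (u, h) \<in> (edge_rel B)\<^sup>*"
    using assms by (auto simp: graph_Union_pair connected_graph_iff)
  then show "(u, h) \<in> (edge_rel (graph_Union {A, B}))\<^sup>*"
    using edge_rel_rtrancl_mono[of A "graph_Union {A, B}"] edge_rel_rtrancl_mono[of B "graph_Union {A, B}"]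
    by (auto simp: graph_Union_pair)
qed

text \<open>After deleting any vertex, one of the two common vertices survives and links the two
  remainders.\<close>

lemma nonseparable_Union_pair:
  assumes "nonseparable_subgraph G A" "nonseparable_subgraph G B"
    and ab: "a \<noteq> b" "a \<in> verts A" "a \<in> verts B" "b \<in> verts A" "b \<in> verts B"
  shows "nonseparable_subgraph G (graph_Union {A, B})"
  unfolding nonseparable_subgraph_def
proof (intro conjI allI)
  note A = assms(1)[unfolded nonseparable_subgraph_def subgraph_def simple_graph_def]
  note B = assms(2)[unfolded nonseparable_subgraph_def subgraph_def simple_graph_def]
  show "subgraph (graph_Union {A, B}) G"
    using A B unfolding subgraph_def simple_graph_def graph_Union_pair by auto
  show "2 \<le> card (verts (graph_Union {A, B}))"
  proof -
    have "card (verts A) \<le> card (verts A \<union> verts B)" using A B by (intro card_mono) auto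
    then show ?thesis using A by (simp add: graph_Union_pair)
  qed
  show "connected_graph (graph_Union {A, B})"
    by (rule connected_graph_Union_pair[of _ _ a]) (use A B ab in auto)
  show "connected_graph (delete_vertex w (graph_Union {A, B}))" for w
  proof -
    have eq: "delete_vertex w (graph_Union {A, B}) = graph_Union {delete_vertex w A, delete_vertex w B}"
      unfolding graph_Union_pair delete_vertex_def by auto
    define h where "h = (if w = a then b else a)"
    have "h \<in> verts (delete_vertex w A)" "h \<in> verts (delete_vertex w B)"
      using ab by (auto simp: h_def delete_vertex_def)
    moreover have "connected_graph (delete_vertex w A)" "connected_graph (delete_vertex w B)"
      using assms(1,2) by (simp_all add: nonseparable_subgraph_def)
    ultimately show ?thesis unfolding eq by (intro connected_graph_Union_pair)
  qed
qed

section \<open>Ears and single edges\<close>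

lemma edge_rel_path_segment:
  assumes "i \<le> j" "\<And>m. i \<le> m \<Longrightarrow> m < j \<Longrightarrow> {p m, p (Suc m)} \<in> edges G"
  shows "(p i, p j) \<in> (edge_rel G)\<^sup>*"
  using assms
proof (induction j rule: dec_induct)
  case (step j)
  then have "(p i, p j) \<in> (edge_rel G)\<^sup>*" "(p j, p (Suc j)) \<in> edge_rel G"
    by (auto simp: edge_rel_def)
  then show ?case by (rule rtrancl_into_rtrancl)
qed simp

text \<open>After deleting \<open>w\<close>, a surviving path vertex still reaches \<open>B\<close>
  along the path, going to \<open>p 0\<close> if \<open>w\<close> does not lie before it and to
  \<open>p k\<close> otherwise.\<close>

lemma nonseparable_ear:
  assumes "simple_graph G" "nonseparable_subgraph G B" "p 0 \<in> verts B" "p k \<in> verts B" "p 0 \<noteq> p k"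
    and inj: "inj_on p {..k}" and edge: "\<And>i. i < k \<Longrightarrow> {p i, p (Suc i)} \<in> edges G"
  shows "nonseparable_subgraph G (verts B \<union> p ` {..k}, edges B \<union> {{p i, p (Suc i)} | i. i < k})"
    (is "nonseparable_subgraph G ?U")
  unfolding nonseparable_subgraph_def
proof (intro conjI allI)
  note B = assms(2)[unfolded nonseparable_subgraph_def subgraph_def simple_graph_def]
  have pv: "p i \<in> verts G" if "i \<le> k" for i
  proof (cases "i = k")
    case True
    then show ?thesis using assms(4) B by auto
  next
    case False
    then show ?thesis using simple_graphD(1)[OF assms(1) edge[of i]] that by auto
  qed
  show "subgraph ?U G"
    unfolding subgraph_def simple_graph_def
  proof (intro conjI)
    show "finite (verts ?U)" using B by auto
    show "verts ?U \<subseteq> verts G" using B pv by auto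
    show "edges ?U \<subseteq> edges G" using B edge by auto
    show "\<forall>e\<in>edges ?U. e \<subseteq> verts ?U \<and> card e = 2"
    proof
      fix e assume "e \<in> edges ?U"
      then consider "e \<in> edges B" | i where "i < k" "e = {p i, p (Suc i)}" by auto
      then show "e \<subseteq> verts ?U \<and> card e = 2"
      proof cases
        case 1
        then show ?thesis using B by auto
      next
        case 2
        then show ?thesis using simple_graphD(2)[OF assms(1) edge[of i]] by auto
      qed
    qed
  qed
  show "2 \<le> card (verts ?U)"
  proof -
    have "card (verts B) \<le> card (verts ?U)" using B by (intro card_mono) auto
    then show ?thesis using B by linarith
  qed
  show "connected_graph ?U"
  proof (rule connected_graph_hub)
    fix u assume "u \<in> verts ?U"
    then consider "u \<in> verts B" | i where "i \<le> k" "u = p i" by auto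
    then show "(u, p 0) \<in> (edge_rel ?U)\<^sup>*"
    proof cases
      case 1
      then have "(u, p 0) \<in> (edge_rel B)\<^sup>*" using B assms(3) by (auto simp: connected_graph_iff)
      then show ?thesis by (rule edge_rel_rtrancl_mono[rotated]) simp
    next
      case 2
      have "(p 0, p i) \<in> (edge_rel ?U)\<^sup>*"
        by (rule edge_rel_path_segment) (use 2 in auto)
      then show ?thesis unfolding 2(2) by (rule edge_rel_rtrancl_sym)
    qed
  qed
  show "connected_graph (delete_vertex w ?U)" for w
  proof -
    \<comment> \<open>An end of the ear that survives the deletion of \<open>w\<close>; it serves as
      the hub.\<close>
    define h where "h = (if w = p 0 then p k else p 0)"
    have h: "h \<in> verts B" "h \<noteq> w" using assms(3-5) by (auto simp: h_def)
    have inB: "(u, h) \<in> (edge_rel (delete_vertex w ?U))\<^sup>*" if "u \<in> verts B" "u \<noteq> w" for u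
    proof -
      have "connected_graph (delete_vertex w B)"
        using assms(2) by (simp add: nonseparable_subgraph_def)
      then have "(u, h) \<in> (edge_rel (delete_vertex w B))\<^sup>*"
        using that h by (auto simp: connected_graph_iff delete_vertex_def)
      then show ?thesis by (rule edge_rel_rtrancl_mono[rotated]) (auto simp: delete_vertex_def)
    qed
    have seg: "(p i, p j) \<in> (edge_rel (delete_vertex w ?U))\<^sup>*"
      if ij: "i \<le> j" "j \<le> k" "\<And>m. i \<le> m \<Longrightarrow> m \<le> j \<Longrightarrow> p m \<noteq> w" for i j
    proof (rule edge_rel_path_segment[OF ij(1)])
      fix m assume m: "i \<le> m" "m < j"
      then have "p m \<noteq> w" "p (Suc m) \<noteq> w" using ij(3) by auto
      then show "{p m, p (Suc m)} \<in> edges (delete_vertex w ?U)"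
        using m ij(2) by (auto simp: delete_vertex_def)
    qed
    show ?thesis
    proof (rule connected_graph_hub)
      fix u assume u: "u \<in> verts (delete_vertex w ?U)"
      then consider "u \<in> verts B" "u \<noteq> w" | i where "i \<le> k" "u = p i" "u \<noteq> w"
        by (auto simp: delete_vertex_def)
      then show "(u, h) \<in> (edge_rel (delete_vertex w ?U))\<^sup>*"
      proof cases
        case 1
        then show ?thesis by (rule inB)
      next
        case 2
        show ?thesis
        proof (cases "\<exists>j\<le>i. p j = w")
          case False
          have "(p 0, p i) \<in> (edge_rel (delete_vertex w ?U))\<^sup>*"
          proof (rule seg)
            fix m assume "m \<le> i"
            then show "p m \<noteq> w" using False by blast
          qed (use 2 in simp_all)
          moreover have "p 0 \<noteq> w" using False by blast
          then have "(p 0, h) \<in> (edge_rel (delete_vertex w ?U))\<^sup>*" by (rule inB[OF assms(3)])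
          ultimately show ?thesis unfolding 2(2) by (rule rtrancl_trans[OF edge_rel_rtrancl_sym])
        next
          case True
          then obtain j where j: "j \<le> i" "p j = w" by blast
          then have "j < i" using 2 by (cases "j = i") auto
          \<comment> \<open>The path is injective and meets \<open>w\<close> before
            \<open>i\<close>, so its remainder avoids \<open>w\<close>.\<close>
          have ne: "p m \<noteq> w" if "i \<le> m" "m \<le> k" for m
          proof
            assume "p m = w"
            then have "m = j" using inj_onD[OF inj, of m j] that(2) j 2(1) by simp
            then show False using that(1) \<open>j < i\<close> by simp
          qed
          have "(p i, p k) \<in> (edge_rel (delete_vertex w ?U))\<^sup>*"
            by (rule seg[OF 2(1) le_refl ne])
          moreover have "(p k, h) \<in> (edge_rel (delete_vertex w ?U))\<^sup>*"
            by (rule inB[OF assms(4) ne[OF 2(1) le_refl]])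
          ultimately show ?thesis unfolding 2(2) by (rule rtrancl_trans)
        qed
      qed
    qed
  qed
qed

lemma nonseparable_edge:
  assumes "simple_graph G" "e \<in> edges G"
  shows "nonseparable_subgraph G (e, {e})"
proof -
  obtain a b where e: "e = {a, b}" "a \<noteq> b"
    using simple_graphD(2)[OF assms] by (auto simp: card_2_iff)
  have "subgraph (e, {e}) G"
    using simple_graphD[OF assms] assms(2) by (auto simp: subgraph_def simple_graph_def e)
  moreover have "connected_graph (e, {e})"
  proof (rule connected_graph_hub[of _ a])
    fix u assume "u \<in> verts (e, {e})"
    then have "u = a \<or> (u, a) \<in> edge_rel (e, {e})" by (auto simp: e edge_rel_def)
    then show "(u, a) \<in> (edge_rel (e, {e}))\<^sup>*" by auto
  qed
  moreover have "connected_graph (delete_vertex v (e, {e}))" for v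
  proof (cases "v \<in> e")
    case True
    then obtain h where "e - {v} \<subseteq> {h}" by (auto simp: e)
    then show ?thesis by (intro connected_graph_hub[of _ h]) (auto simp: delete_vertex_def)
  next
    case False
    then have "delete_vertex v (e, {e}) = (e, {e})" by (auto simp: delete_vertex_def)
    then show ?thesis using \<open>connected_graph (e, {e})\<close> by simp
  qed
  ultimately show ?thesis
    using simple_graphD(2)[OF assms] by (simp add: nonseparable_subgraph_def)
qed

text \<open>A bypass would leave the reachability relation, and with it the number of components,
  unchanged.\<close>

lemma bridge_not_bypassed:
  assumes "bridge G {a, b}"
  shows "(a, b) \<notin> (edge_rel (delete_edge {a, b} G))\<^sup>*"
proof
  assume ab: "(a, b) \<in> (edge_rel (delete_edge {a, b} G))\<^sup>*"
  have "edge_rel G \<subseteq> (edge_rel (delete_edge {a, b} G))\<^sup>*"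
  proof
    fix q assume "q \<in> edge_rel G"
    then obtain x y where q: "q = (x, y)" "{x, y} \<in> edges G" by (auto simp: edge_rel_def)
    show "q \<in> (edge_rel (delete_edge {a, b} G))\<^sup>*"
    proof (cases "{x, y} = {a, b}")
      case True
      then have "x = a \<and> y = b \<or> x = b \<and> y = a" by (auto simp: doubleton_eq_iff)
      then show ?thesis using q(1) ab edge_rel_rtrancl_sym[OF ab] by auto
    next
      case False
      then show ?thesis using q by (auto simp: edge_rel_def delete_edge_def)
    qed
  qed
  then have "(edge_rel G)\<^sup>* \<subseteq> (edge_rel (delete_edge {a, b} G))\<^sup>*"
    by (rule rtrancl_subset_rtrancl)
  moreover have "(edge_rel (delete_edge {a, b} G))\<^sup>* \<subseteq> (edge_rel G)\<^sup>*"
    by (rule rtrancl_mono) (auto simp: edge_rel_def delete_edge_def)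
  ultimately have "reachability G = reachability (delete_edge {a, b} G)"
    unfolding reachability_def edge_rel_def[symmetric] by (auto simp: delete_edge_def)
  then have "components_of_graph G = components_of_graph (delete_edge {a, b} G)"
    by (simp add: components_of_graph_def delete_edge_def)
  then show False using assms by (simp add: bridge_def)
qed

text \<open>With a third vertex \<open>c\<close> in \<open>H\<close>, each end of \<open>e\<close>
  reaches \<open>c\<close> after deletion of the other end, hence without using \<open>e\<close>.
  This bypasses the bridge.\<close>

lemma bridge_not_in_nonseparable:
  assumes "bridge G e" "e \<in> edges H" "nonseparable_subgraph G H"
  shows "card (verts H) < 3"
proof (rule ccontr)
  assume *: "\<not> card (verts H) < 3"
  note H = assms(3)[unfolded nonseparable_subgraph_def subgraph_def]
  have e2: "e \<subseteq> verts H" "card e = 2" using simple_graphD[of H e] H assms(2) by auto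
  then obtain a b where e: "e = {a, b}" "a \<noteq> b" by (auto simp: card_2_iff)
  have "\<not> verts H \<subseteq> {a, b}"
  proof
    assume "verts H \<subseteq> {a, b}"
    then have "card (verts H) \<le> card {a, b}" by (intro card_mono) auto
    then show False using * e(2) by simp
  qed
  then obtain c where c: "c \<in> verts H" "c \<noteq> a" "c \<noteq> b" by blast
  have del: "(u, c) \<in> (edge_rel (delete_edge e G))\<^sup>*" if "u \<in> e" "w \<in> e" "u \<noteq> w" for u w
  proof -
    have "connected_graph (delete_vertex w H)" using H by blast
    then have "(u, c) \<in> (edge_rel (delete_vertex w H))\<^sup>*"
      using that e2(1) c e by (auto simp: connected_graph_iff delete_vertex_def)
    then show ?thesis
      by (rule edge_rel_rtrancl_mono[rotated]) (use that H in \<open>auto simp: delete_vertex_def delete_edge_def\<close>)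
  qed
  have "(a, c) \<in> (edge_rel (delete_edge e G))\<^sup>*" "(b, c) \<in> (edge_rel (delete_edge e G))\<^sup>*"
    using del[of a b] del[of b a] e by auto
  then have "(a, b) \<in> (edge_rel (delete_edge e G))\<^sup>*" by (metis edge_rel_rtrancl_sym rtrancl_trans)
  then show False using bridge_not_bypassed[of G a b] assms(1) e by simp
qed

section \<open>Blocks as maximal nonseparable subgraphs\<close>

lemma block_nonseparable:
  assumes "simple_graph G" "B \<in> blocks G"
  shows "nonseparable_subgraph G B"
  using assms(2) unfolding blocks_def
proof
  assume "B \<in> {B. maximal_two_connected_subgraph G B}"
  then show ?thesis using two_connected_iff[of B G] by (simp add: maximal_two_connected_subgraph_def)
next
  assume "B \<in> {(e, {e}) | e. bridge G e}"
  then show ?thesis using nonseparable_edge[OF assms(1)] by (auto simp: bridge_def)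
qed

text \<open>Above a 2-connected block, \<open>H\<close> has at least three vertices and is
  2-connected itself. Above a bridge, \<open>H\<close> has only two vertices and is that single
  edge.\<close>

lemma block_maximal_nonseparable:
  assumes "B \<in> blocks G" "nonseparable_subgraph G H" "verts B \<subseteq> verts H" "edges B \<subseteq> edges H"
  shows "H = B"
  using assms(1) unfolding blocks_def
proof
  note H = assms(2)[unfolded nonseparable_subgraph_def]
  have fin: "finite (verts H)" "simple_graph H" using H by (auto simp: subgraph_def simple_graph_def)
  {
    assume "B \<in> {B. maximal_two_connected_subgraph G B}"
    then have B: "two_connected B" "subgraph B G"
      "\<And>H. subgraph H G \<Longrightarrow> two_connected H \<Longrightarrow> subgraph B H \<Longrightarrow> H = B"
      by (auto simp: maximal_two_connected_subgraph_def)
    have "card (verts B) \<le> card (verts H)" using fin assms(3) by (intro card_mono)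
    then have "two_connected H" using B(1) two_connected_iff[of H G] assms(2) H
      by (auto simp: two_connected_def)
    moreover have "subgraph B H" using B(2) assms(3,4) by (simp add: subgraph_def)
    ultimately show ?thesis using B(3) H by blast
  next
    assume "B \<in> {(e, {e}) | e. bridge G e}"
    then obtain e where e: "B = (e, {e})" "bridge G e" by blast
    have eH: "e \<in> edges H" "e \<subseteq> verts H" using assms(3,4) e by auto
    have c: "card e = 2" using simple_graphD(2)[OF fin(2) eH(1)] .
    have "card (verts H) = 2" using bridge_not_in_nonseparable[OF e(2) eH(1) assms(2)] H by linarith
    then have v: "verts H = e" using card_subset_eq[OF fin(1) eH(2)] c by simp
    have "e' = e" if "e' \<in> edges H" for e'
      using simple_graphD[OF fin(2) that] card_subset_eq[of e e'] v c fin(1) by simp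
    then have "edges H = {e}" using eH(1) by blast
    then show ?thesis using v e(1) by (simp add: prod_eq_iff)
  }
qed

text \<open>A common edge gives two common vertices, so the union is nonseparable and by maximality
  equals both blocks.\<close>

lemma blocks_edge_disjoint:
  assumes "simple_graph G" "A \<in> blocks G" "B \<in> blocks G" "e \<in> edges A" "e \<in> edges B"
  shows "A = B"
proof -
  note A = block_nonseparable[OF assms(1,2)] and B = block_nonseparable[OF assms(1,3)]
  have sA: "simple_graph A" and sB: "simple_graph B"
    using A B by (simp_all add: nonseparable_subgraph_def subgraph_def)
  obtain a b where "e = {a, b}" "a \<noteq> b" using simple_graphD(2)[OF sA assms(4)] by (auto simp: card_2_iff)
  then have "nonseparable_subgraph G (graph_Union {A, B})"
    using nonseparable_Union_pair[OF A B, of a b] simple_graphD(1)[OF sA assms(4)] simple_graphD(1)[OF sB assms(5)]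
    by simp
  then have "graph_Union {A, B} = A" "graph_Union {A, B} = B"
    using block_maximal_nonseparable[OF assms(2)] block_maximal_nonseparable[OF assms(3)]
    by (simp_all add: graph_Union_pair)
  then show ?thesis by simp
qed

text \<open>Take a shortest path: a repeated vertex would allow a shortcut.\<close>

lemma rtrancl_injective_path:
  assumes "(u, v) \<in> R\<^sup>*"
  obtains p k where "p 0 = u" "p k = v" "inj_on p {..k::nat}" "\<And>i. i < k \<Longrightarrow> (p i, p (Suc i)) \<in> R"
proof -
  define k where "k = (LEAST n. (u, v) \<in> R ^^ n)"
  have "\<exists>n. (u, v) \<in> R ^^ n" using assms by (simp add: rtrancl_power)
  then have k: "(u, v) \<in> R ^^ k" unfolding k_def by (rule LeastI_ex)
  have min: "k \<le> n" if "(u, v) \<in> R ^^ n" for n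
    unfolding k_def using that by (rule Least_le)
  obtain p where p: "p 0 = u" "p k = v" "\<And>i. i < k \<Longrightarrow> (p i, p (Suc i)) \<in> R"
    using k by (auto simp: relpow_fun_conv)
  have seg: "(p i, p (i + n)) \<in> R ^^ n" if "i + n \<le> k" for i n
    using that
  proof (induction n)
    case (Suc n)
    then show ?case using p(3)[of "i + n"] by auto
  qed simp
  have ne: "p i \<noteq> p j" if "i < j" "j \<le> k" for i j
  proof
    assume eq: "p i = p j"
    have "(u, p i) \<in> R ^^ i" using seg[of 0 i] that p(1) by simp
    moreover have "(p i, v) \<in> R ^^ (k - j)" using seg[of j "k - j"] that p(2) eq by simp
    ultimately have "(u, v) \<in> R ^^ (i + (k - j))" by (auto simp: relpow_add)
    then show False using min that by fastforce
  qed
  then have "inj_on p {..k}" by (intro linorder_inj_onI) auto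
  with p show ?thesis using that by blast
qed

text \<open>For \<open>u \<noteq> v\<close>, a path between them in the union of \<A> is an ear of
  \<open>B\<close>. By maximality \<open>B\<close> contains it, so its first edge lies both in
  \<open>B\<close> and in a block from \<A>, against edge-disjointness.\<close>

lemma block_meets_connected_once:
  assumes "simple_graph G" "\<A> \<subseteq> blocks G" "connected_graph (graph_Union \<A>)" "B \<in> blocks G" "B \<notin> \<A>"
    and "u \<in> verts B" "v \<in> verts B" "u \<in> verts (graph_Union \<A>)" "v \<in> verts (graph_Union \<A>)"
  shows "u = v"
proof (rule ccontr)
  assume uv: "u \<noteq> v"
  note B = block_nonseparable[OF assms(1,4)]
  have "(u, v) \<in> (edge_rel (graph_Union \<A>))\<^sup>*" using assms(3,8,9) by (auto simp: connected_graph_iff)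
  then obtain p k where p: "p 0 = u" "p k = v" "inj_on p {..k::nat}"
    "\<And>i. i < k \<Longrightarrow> (p i, p (Suc i)) \<in> edge_rel (graph_Union \<A>)"
    by (rule rtrancl_injective_path) (rule that)
  have edge: "\<exists>A\<in>\<A>. {p i, p (Suc i)} \<in> edges A" if "i < k" for i
    using p(4)[OF that] by (auto simp: edge_rel_def graph_Union_def)
  have "edges A \<subseteq> edges G" if "A \<in> \<A>" for A
    using block_nonseparable[OF assms(1) subsetD[OF assms(2) that]]
    by (simp add: nonseparable_subgraph_def subgraph_def)
  then have edgeG: "{p i, p (Suc i)} \<in> edges G" if "i < k" for i using edge[OF that] by blast
  let ?U = "(verts B \<union> p ` {..k}, edges B \<union> {{p i, p (Suc i)} | i. i < k})"
  have "nonseparable_subgraph G ?U"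
    by (rule nonseparable_ear[OF assms(1) B _ _ _ p(3) edgeG]) (use p uv assms(6,7) in auto)
  then have "?U = B" by (rule block_maximal_nonseparable[OF assms(4)]) auto
  moreover have "0 < k" using p uv by (cases k) auto
  ultimately have "{p 0, p (Suc 0)} \<in> edges B" by (auto simp: prod_eq_iff)
  moreover obtain A where "A \<in> \<A>" "{p 0, p (Suc 0)} \<in> edges A" using edge[OF \<open>0 < k\<close>] by blast
  ultimately show False using blocks_edge_disjoint[OF assms(1) _ assms(4)] assms(2,5) by blast
qed

section \<open>The intersection graph of the blocks\<close>

definition block_adj :: "'a graph \<Rightarrow> 'a graph \<Rightarrow> bool" where
  "block_adj A B \<longleftrightarrow> verts A \<inter> verts B \<noteq> {}"

lemma symp_block_adj: "symp block_adj"
  by (auto simp: symp_def block_adj_def)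

text \<open>Forwards, the blocks reachable from \<open>u\<close> form a closed family. Backwards, a
  walk that starts in a block of a closed family \<C> never leaves the blocks of \<C>.\<close>

lemma conn_block_adj_iff:
  assumes "simple_graph G" "\<A> \<subseteq> blocks G"
  shows "conn block_adj \<A> \<longleftrightarrow> connected_graph (graph_Union \<A>)"
proof
  have ns: "nonseparable_subgraph G B" if "B \<in> \<A>" for B
    using block_nonseparable assms that by blast
  have cB: "(x, y) \<in> (edge_rel (graph_Union \<A>))\<^sup>*" if "B \<in> \<A>" "x \<in> verts B" "y \<in> verts B" for B x y
  proof -
    have "(x, y) \<in> (edge_rel B)\<^sup>*" using ns[OF that(1)] that(2,3)
      by (auto simp: nonseparable_subgraph_def connected_graph_iff)
    then show ?thesis by (rule edge_rel_rtrancl_mono[rotated]) (use that(1) in \<open>auto simp: graph_Union_def\<close>)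
  qed
  {
    assume conn: "conn block_adj \<A>"
    show "connected_graph (graph_Union \<A>)"
      unfolding connected_graph_iff
    proof (intro ballI)
      fix u v assume u: "u \<in> verts (graph_Union \<A>)" and v: "v \<in> verts (graph_Union \<A>)"
      let ?R = "{B \<in> \<A>. \<forall>x\<in>verts B. (u, x) \<in> (edge_rel (graph_Union \<A>))\<^sup>*}"
      have "?R = \<A>"
      proof (rule connD[OF conn])
        obtain B where "B \<in> \<A>" "u \<in> verts B" using u by (auto simp: graph_Union_def)
        then show "?R \<noteq> {}" using cB by blast
        fix A B assume A: "A \<in> ?R" and B: "B \<in> \<A> - ?R"
        show "\<not> block_adj A B"
        proof
          assume "block_adj A B"
          then obtain x where "x \<in> verts A" "x \<in> verts B" by (auto simp: block_adj_def)
          then have "\<forall>y\<in>verts B. (u, y) \<in> (edge_rel (graph_Union \<A>))\<^sup>*"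
            using A B cB[of B x] rtrancl_trans[of u x] by auto
          then show False using B by blast
        qed
      qed auto
      then show "(u, v) \<in> (edge_rel (graph_Union \<A>))\<^sup>*"
        using v by (auto simp: graph_Union_def)
    qed
  next
    assume con: "connected_graph (graph_Union \<A>)"
    have nonempty: "verts B \<noteq> {}" if "B \<in> \<A>" for B
      using ns[OF that] by (auto simp: nonseparable_subgraph_def)
    have sub: "e \<subseteq> verts B" if "B \<in> \<A>" "e \<in> edges B" for B e
      using ns[OF that(1)] simple_graphD(1)[of B e] that(2) by (auto simp: nonseparable_subgraph_def subgraph_def)
    show "conn block_adj \<A>"
    proof (rule connI)
      fix \<C> assume C: "\<C> \<subseteq> \<A>" "\<C> \<noteq> {}" "\<And>A B. A \<in> \<C> \<Longrightarrow> B \<in> \<A> - \<C> \<Longrightarrow> \<not> block_adj A B"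
      obtain A u where A: "A \<in> \<C>" "u \<in> verts A" using C(1,2) nonempty by blast
      have mem: "B \<in> \<C>" if "B \<in> \<A>" "x \<in> verts B" "A' \<in> \<C>" "x \<in> verts A'" for B A' x
        using C(3)[of A' B] that by (auto simp: block_adj_def)
      have reach: "\<exists>A'\<in>\<C>. v \<in> verts A'" if "(u, v) \<in> (edge_rel (graph_Union \<A>))\<^sup>*" for v
        using that
      proof induction
        case base
        then show ?case using A by blast
      next
        case (step y z)
        then obtain A' B where *: "A' \<in> \<C>" "y \<in> verts A'" "B \<in> \<A>" "{y, z} \<in> edges B"
          by (auto simp: edge_rel_def graph_Union_def)
        then have "y \<in> verts B" "z \<in> verts B" using sub by blast+
        then show ?case using mem[of B y A'] * by blast
      qed
      show "\<A> \<subseteq> \<C>"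
      proof
        fix B assume B: "B \<in> \<A>"
        then obtain v where v: "v \<in> verts B" using nonempty by blast
        have "(u, v) \<in> (edge_rel (graph_Union \<A>))\<^sup>*"
          using con A C(1) B v by (auto simp: connected_graph_iff graph_Union_def)
        then show "B \<in> \<C>" using reach mem[OF B v] by blast
      qed
    qed
  }
qed

text \<open>Two blocks of a connected family that meet \<open>B\<close> do so in the same vertex,
  which they therefore share.\<close>

lemma block_graph_blocks:
  assumes "simple_graph G"
  shows "block_graph block_adj (blocks G)"
  unfolding block_graph_def
proof (intro conjI allI impI ballI)
  show "symp block_adj" by (rule symp_block_adj)
  fix \<A> B A A'
  assume \<A>: "\<A> \<subseteq> blocks G" "conn block_adj \<A>" and B: "B \<in> blocks G - \<A>"
    and A: "A \<in> \<A>" "A' \<in> \<A>" "block_adj A B" "block_adj A' B"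
  obtain x y where xy: "x \<in> verts A" "x \<in> verts B" "y \<in> verts A'" "y \<in> verts B"
    using A by (auto simp: block_adj_def)
  have "connected_graph (graph_Union \<A>)" using conn_block_adj_iff[OF assms \<A>(1)] \<A>(2) by simp
  then have "x = y"
    by (rule block_meets_connected_once[OF assms \<A>(1), of B]) (use B A xy in \<open>auto simp: graph_Union_def\<close>)
  then show "A = A' \<or> block_adj A A'" using xy by (auto simp: block_adj_def)
qed

section \<open>Lattice points of the connected blocks polytope\<close>

text \<open>Defined for any relation; with \<open>block_adj\<close> on the blocks it is the
  connected blocks polytope.\<close>

definition conn_polytope :: "('b::finite \<Rightarrow> 'b \<Rightarrow> bool) \<Rightarrow> 'b set \<Rightarrow> (real ^ 'b) set" where
  "conn_polytope E V = convex hull {incidence_vector A | A. A \<subseteq> V \<and> conn E A}"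

definition to_vec :: "('b::finite \<Rightarrow> nat) \<Rightarrow> real ^ 'b" where
  "to_vec x = (\<chi> b. real (x b))"

lemma zero_in_conn_polytope: "0 \<in> conn_polytope E V"
proof -
  have "(0 :: real ^ 'b) = incidence_vector {}" by (simp add: incidence_vector_def vec_eq_iff)
  then show ?thesis unfolding conn_polytope_def by (intro hull_inc) auto
qed

text \<open>The missing weight is placed at the origin.\<close>

lemma convex_sum_le_1:
  assumes "convex C" "0 \<in> C" "finite I" "\<And>i. i \<in> I \<Longrightarrow> 0 \<le> a i" "sum a I \<le> 1" "\<And>i. i \<in> I \<Longrightarrow> y i \<in> C"
  shows "(\<Sum>i\<in>I. a i *\<^sub>R y i) \<in> C"
proof (cases "sum a I = 0")
  case True
  then have "\<forall>i\<in>I. a i = 0" using sum_nonneg_eq_0_iff[OF assms(3), of a] assms(4) by simp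
  then show ?thesis using assms(2) by simp
next
  case False
  then have pos: "0 < sum a I" using sum_nonneg[of I a] assms(4) by force
  have "(\<Sum>i\<in>I. (a i / sum a I) *\<^sub>R y i) \<in> C"
    using assms pos by (intro convex_sum) (auto simp: sum_divide_distrib[symmetric])
  then have "(1 - sum a I) *\<^sub>R 0 + sum a I *\<^sub>R (\<Sum>i\<in>I. (a i / sum a I) *\<^sub>R y i) \<in> C"
    using assms(1,2,5) pos by (intro convexD) auto
  then show ?thesis using pos by (simp add: scaleR_right.sum)
qed

text \<open>Layer-cake decomposition: \<open>b\<close> lies in exactly one component of each of the
  levels \<open>1, ..., x b\<close>.\<close>

lemma to_vec_eq_sum:
  fixes x :: "'b::finite \<Rightarrow> nat"
  assumes "symp E" "\<And>v. x v \<le> N"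
  shows "to_vec x = (\<Sum>(j, S)\<in>Sigma {1..N} (\<lambda>j. comps E (level x j)). incidence_vector S)"
proof -
  have "(\<Sum>S\<in>comps E (level x j). incidence_vector S $ b) = (if b \<in> level x j then 1 else (0::real))" for j b
  proof (cases "b \<in> level x j")
    case True
    then obtain T where T: "T \<in> comps E (level x j)" "b \<in> T" using Union_comps[OF assms(1)] by blast
    have "b \<notin> S" if "S \<in> comps E (level x j) - {T}" for S
      using comps_apart[OF assms(1) _ T(1), of S b b] that T(2) by blast
    then have "(\<Sum>S\<in>comps E (level x j) - {T}. incidence_vector S $ b) = (0::real)"
      by (intro sum.neutral) (simp add: incidence_vector_def)
    then show ?thesis using T True by (simp add: sum.remove[OF _ T(1)] incidence_vector_def)
  next
    case False
    then have "b \<notin> S" if "S \<in> comps E (level x j)" for S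
      using compsD(1)[OF that] by blast
    then show ?thesis using False by (simp add: incidence_vector_def)
  qed
  then have "(\<Sum>(j, S)\<in>Sigma {1..N} (\<lambda>j. comps E (level x j)). incidence_vector S) $ b = (\<Sum>j=1..N. if b \<in> level x j then 1 else (0::real))" for b
    by (simp add: sum.Sigma[symmetric] sum_component)
  also have "(\<Sum>j=1..N. if b \<in> level x j then 1 else (0::real)) = (\<Sum>j=1..x b. 1)" for b
    using assms(2)[of b] by (intro sum.mono_neutral_cong_right) (auto simp: level_def)
  finally show ?thesis by (simp add: to_vec_def vec_eq_iff)
qed

text \<open>The decomposition has \<open>comp_sum E x \<le> n\<close> summands, all of them
  generators of the polytope; each gets weight \<open>1 / n\<close>.\<close>

lemma to_vec_in_dilate:
  fixes x :: "'b::finite \<Rightarrow> nat"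
  assumes "symp E" "x \<in> vecs V" "comp_sum E x \<le> n"
  shows "to_vec x \<in> (\<lambda>p. real n *\<^sub>R p) ` conn_polytope E V"
proof -
  obtain N where N: "\<And>v. x v \<le> N" using vecs_bounded[OF finite assms(2)] by blast
  let ?I = "Sigma {1..N} (\<lambda>j. comps E (level x j))"
  let ?y = "\<lambda>(j, S). incidence_vector S :: real ^ 'b"
  have c: "card ?I = comp_sum E x" by (simp add: comp_sum_eq[OF N])
  have y: "?y i \<in> conn_polytope E V" if "i \<in> ?I" for i
  proof -
    obtain j S where i: "i = (j, S)" "j \<in> {1..N}" "S \<in> comps E (level x j)" using \<open>i \<in> ?I\<close> by blast
    then have "S \<subseteq> V" "conn E S" using compsD(1,3)[OF i(3)] level_subset[OF assms(2), of j] by auto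
    then show ?thesis unfolding conn_polytope_def i(1) by (intro hull_inc) auto
  qed
  show ?thesis
  proof (cases "n = 0")
    case True
    moreover have "finite ?I" by simp
    ultimately have "?I = {}" using c assms(3) by (metis card_0_eq le_zero_eq)
    then have "to_vec x = 0" using to_vec_eq_sum[OF assms(1) N] by (simp only: sum.empty)
    then show ?thesis using True zero_in_conn_polytope[of E V] by auto
  next
    case False
    have "(\<Sum>i\<in>?I. (1 / real n) *\<^sub>R ?y i) \<in> conn_polytope E V"
    proof (rule convex_sum_le_1)
      show "convex (conn_polytope E V)" by (simp add: conn_polytope_def)
      show "(\<Sum>i\<in>?I. 1 / real n) \<le> 1" using c assms(3) False by simp
    qed (use zero_in_conn_polytope y in auto)
    moreover have "to_vec x = real n *\<^sub>R (\<Sum>i\<in>?I. (1 / real n) *\<^sub>R ?y i)"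
      using False by (simp add: to_vec_eq_sum[OF assms(1) N] scaleR_right.sum)
    ultimately show ?thesis by blast
  qed
qed

text \<open>The supporting functional is at most 1 on every generator, since a connected set has at
  most one component. So it is at most \<open>n\<close> on the dilate, while its value at
  \<open>x\<close> is \<open>comp_sum E x\<close>.\<close>

lemma dilate_comp_sum_le:
  fixes x :: "'b::finite \<Rightarrow> nat"
  assumes "block_graph E V" "x \<in> vecs V" "to_vec x \<in> (\<lambda>p. real n *\<^sub>R p) ` conn_polytope E V"
  shows "comp_sum E x \<le> n"
proof -
  obtain l :: "'b \<Rightarrow> int" where l: "\<And>A. A \<subseteq> V \<Longrightarrow> sum l A \<le> int (card (comps E A))"
    "(\<Sum>v\<in>V. l v * int (x v)) = int (comp_sum E x)"
    using supporting_functional[OF finite assms(1,2)] by blast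
  define a :: "real ^ 'b" where "a = (\<chi> v. if v \<in> V then real_of_int (l v) else 0)"
  have inner: "a \<bullet> p = (\<Sum>v\<in>V. real_of_int (l v) * p $ v)" for p
    unfolding inner_vec_def a_def by (intro sum.mono_neutral_cong_right) auto
  have "conn_polytope E V \<subseteq> {p. a \<bullet> p \<le> 1}"
    unfolding conn_polytope_def
  proof (rule hull_minimal[where S = convex])
    show "{incidence_vector A | A. A \<subseteq> V \<and> conn E A} \<subseteq> {p. a \<bullet> p \<le> 1}"
    proof clarify
      fix A assume A: "A \<subseteq> V" "conn E A"
      have "a \<bullet> incidence_vector A = real_of_int (sum l A)"
        unfolding inner of_int_sum
        by (intro sum.mono_neutral_cong_right) (use A(1) in \<open>auto simp: incidence_vector_def\<close>)
      moreover have "sum l A \<le> 1"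
        using l(1)[OF A(1)] comps_conn[OF block_graph_symp[OF assms(1)] A(2)] by (cases "A = {}") auto
      ultimately show "a \<bullet> incidence_vector A \<le> 1" by (simp only: of_int_le_1_iff)
    qed
  qed (rule convex_halfspace_le)
  then have "a \<bullet> to_vec x \<le> real n"
    using assms(3) mult_left_mono[of _ 1 "real n"] by fastforce
  also have "a \<bullet> to_vec x = real_of_int (\<Sum>v\<in>V. l v * int (x v))"
    unfolding inner by (simp add: to_vec_def)
  finally show ?thesis unfolding l(2) by simp
qed

lemma conn_polytope_nonneg:
  assumes "p \<in> conn_polytope E V"
  shows "0 \<le> p $ b" "b \<notin> V \<Longrightarrow> p $ b = 0"
proof -
  have "conn_polytope E V \<subseteq> {p. \<forall>b. 0 \<le> p $ b \<and> (b \<notin> V \<longrightarrow> p $ b = 0)}"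
    unfolding conn_polytope_def
    by (rule hull_minimal[where S = convex]) (auto simp: incidence_vector_def convex_def)
  then show "0 \<le> p $ b" "b \<notin> V \<Longrightarrow> p $ b = 0" using assms by auto
qed

lemma ehrhart_count_conn_polytope:
  fixes E :: "'b::finite \<Rightarrow> 'b \<Rightarrow> bool"
  assumes "block_graph E V"
  shows "ehrhart_count (conn_polytope E V) n = card {x \<in> vecs V. comp_sum E x \<le> n}"
proof -
  have sE: "symp E" using assms by (rule block_graph_symp)
  have "{y \<in> (\<lambda>p. real n *\<^sub>R p) ` conn_polytope E V. \<forall>b. y $ b \<in> \<int>} = to_vec ` {x \<in> vecs V. comp_sum E x \<le> n}"
  proof
    show "to_vec ` {x \<in> vecs V. comp_sum E x \<le> n} \<subseteq> {y \<in> (\<lambda>p. real n *\<^sub>R p) ` conn_polytope E V. \<forall>b. y $ b \<in> \<int>}"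
      using to_vec_in_dilate[OF sE] by (auto simp: to_vec_def)
    show "{y \<in> (\<lambda>p. real n *\<^sub>R p) ` conn_polytope E V. \<forall>b. y $ b \<in> \<int>} \<subseteq> to_vec ` {x \<in> vecs V. comp_sum E x \<le> n}"
    proof
      fix y assume "y \<in> {y \<in> (\<lambda>p. real n *\<^sub>R p) ` conn_polytope E V. \<forall>b. y $ b \<in> \<int>}"
      then have y: "y \<in> (\<lambda>p. real n *\<^sub>R p) ` conn_polytope E V" "\<And>b. y $ b \<in> \<int>" by auto
      then obtain p where p: "p \<in> conn_polytope E V" "y = real n *\<^sub>R p" by blast
      define x where "x b = nat \<lfloor>y $ b\<rfloor>" for b
      have yx: "y = to_vec x"
        unfolding vec_eq_iff
      proof
        fix b
        have "0 \<le> y $ b" using conn_polytope_nonneg(1)[OF p(1)] p(2) by simp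
        then show "y $ b = to_vec x $ b" using y(2)[of b] by (auto simp: to_vec_def x_def elim!: Ints_cases)
      qed
      have "x \<in> vecs V" using conn_polytope_nonneg(2)[OF p(1)] p(2) by (auto simp: vecs_def x_def)
      then show "y \<in> to_vec ` {x \<in> vecs V. comp_sum E x \<le> n}"
        using dilate_comp_sum_le[OF assms, of x n] y(1) yx by auto
    qed
  qed
  moreover have "inj_on to_vec {x \<in> vecs V. comp_sum E x \<le> n}"
    by (auto intro!: inj_onI simp: to_vec_def vec_eq_iff)
  ultimately show ?thesis unfolding ehrhart_count_def by (simp add: card_image)
qed

text \<open>Singletons are connected, so the generators include the unit vectors of
  \<open>V\<close>, which span all the others; the origin belongs to the polytope.\<close>

lemma aff_dim_conn_polytope:
  fixes V :: "'b::finite set"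
  shows "aff_dim (conn_polytope E V) = int (card V)"
proof -
  let ?S = "{incidence_vector A | A. A \<subseteq> V \<and> conn E A} :: (real ^ 'b) set"
  let ?B = "(\<lambda>b. axis b 1) ` V :: (real ^ 'b) set"
  have ax: "axis b 1 = (incidence_vector {b} :: real ^ 'b)" for b
    by (auto simp: axis_def incidence_vector_def vec_eq_iff)
  have BS: "?B \<subseteq> ?S" by (auto simp: ax intro!: exI[of _ "{_}"])
  have "?S \<subseteq> span ?B"
  proof clarify
    fix A assume "A \<subseteq> V"
    have "(incidence_vector A :: real ^ 'b) = (\<Sum>b\<in>A. axis b 1)"
      by (simp add: vec_eq_iff incidence_vector_def sum_component axis_def)
    also have "\<dots> \<in> span ?B"
      by (intro span_sum span_base) (use \<open>A \<subseteq> V\<close> in auto)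
    finally show "(incidence_vector A :: real ^ 'b) \<in> span ?B" .
  qed
  moreover have "?B \<subseteq> span ?S" using BS span_superset by (rule subset_trans)
  ultimately have "span ?S = span ?B" by (simp only: span_eq)
  then have "dim ?S = dim ?B" by (rule span_eq_dim)
  also have "dim ?B = card ?B"
  proof (rule dim_eq_card_independent)
    have "?B \<subseteq> Basis" by (auto simp: Basis_vec_def)
    then show "independent ?B" by (rule independent_mono[OF independent_Basis])
  qed
  also have "card ?B = card V" by (rule card_image) (auto simp: inj_on_def axis_eq_axis)
  finally have "dim ?S = card V" .
  moreover have "0 \<in> affine hull ?S"
    using zero_in_conn_polytope[of E V] convex_hull_subset_affine_hull unfolding conn_polytope_def by blast
  ultimately show ?thesis
    unfolding conn_polytope_def aff_dim_convex_hull by (simp add: aff_dim_zero)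
qed

lemma connected_blocks_polytope_eq:
  fixes G :: "'a::finite graph"
  assumes "simple_graph G"
  shows "connected_blocks_polytope G = conn_polytope block_adj (blocks G)"
proof -
  have "{incidence_vector \<A> | \<A>. \<A> \<subseteq> blocks G \<and> connected_graph (graph_Union \<A>)} =
    ({incidence_vector \<A> | \<A>. \<A> \<subseteq> blocks G \<and> conn block_adj \<A>} :: (real ^ 'a graph) set)"
    using conn_block_adj_iff[OF assms] by blast
  then show ?thesis by (simp add: connected_blocks_polytope_def conn_polytope_def)
qed

theorem corollary7p4:
  fixes G :: "'a::finite graph"
  assumes "simple_graph G" and "connected_graph G"
  shows "unimodal (hstar_vector (connected_blocks_polytope G))"
proof -
  let ?V = "blocks G" and ?P = "connected_blocks_polytope G"
  have bg: "block_graph block_adj ?V" by (rule block_graph_blocks[OF assms(1)])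
  obtain D where D: "D \<le> card ?V" "gamma_pos D (comp_numer block_adj ?V)"
    using gamma_pos_comp_numer[OF finite bg] by blast
  have dim: "nat (aff_dim ?P) = card ?V"
    unfolding connected_blocks_polytope_eq[OF assms(1)] aff_dim_conn_polytope by simp
  \<comment> \<open>The dimension equals the number of blocks, so the power of \<open>geom\<close>
    is the one with which \<open>comp_numer\<close> yields the lattice point counts.\<close>
  have "hstar_vector ?P = map (fps_nth (comp_numer block_adj ?V)) [0..<Suc (nat (aff_dim ?P))]"
  proof (rule hstar_vector_eqI)
    show "int (ehrhart_count ?P n) = fps_nth (comp_numer block_adj ?V * geom ^ Suc (nat (aff_dim ?P))) n" for n
      unfolding dim unfolding connected_blocks_polytope_eq[OF assms(1)] ehrhart_count_conn_polytope[OF bg]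
      by (rule card_comp_sum_le[OF symp_block_adj finite])
    show "fps_nth (comp_numer block_adj ?V) i = 0" if "nat (aff_dim ?P) < i" for i
      using gamma_pos_nth_gt[OF D(2), of i] D(1) that dim by simp
  qed
  then show ?thesis using unimodal_gamma_pos[OF D(2,1)] dim by simp
qed

end
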